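(* Given four spin-decorated horospheres $(\mathfrak{h}_n,W_n)$ in $\mathcal{H}^4$, $n=0,1,2,3$, let $\lambda_{mn}$ denote the lambda length from $(\mathfrak{h}_m,W_m)$ to $(\mathfrak{h}_n,W_n)$. Then $$\lambda_{02}^{-1}\lambda_{01}\lambda_{31}^{-1}\lambda_{32}+\lambda_{02}^{-1}\lambda_{03}\lambda_{13}^{-1}\lambda_{12}=1.$$
   Context: $\mathcal{H}^4$ is hyperbolic 4-space (hyperboloid $\{x\in\mathbb{R}^{1,4}:\langle x,x\rangle=1,T>0\}$, with the standard orientation; in the upper half-space model $(\partial_w,\partial_x,\partial_y,\partial_z)$ is positive). Quaternions $\mathbb{H}$, paravectors $\mathcal{V}=\mathrm{span}_\mathbb{R}\{1,i,j\}$. A horosphere is $\{x\in\mathcal{H}^4:\langle x,p\rangle=1\}$ for $p$ on the future light cone. A decoration on a horosphere is a pair of perpendicular, parallel, oriented tangent line fields, with unit fields $v^i,v^j$; with inward normal $N^{in}$ (away from the centre) and outward normal $N^{out}=-N^{in}$, the inward/outward frame fields are the oriented orthonormal frames $(v^{1,in},v^i,v^j,N^{in})$ and $(v^{1,out},v^i,v^j,N^{out})$. A spin decoration is a pair $(W^{in},W^{out})$ of continuous lifts of these frame fields to the spin double cover of the oriented orthonormal frame bundle of $\mathcal{H}^4$, with $W^{in}$ obtained from $W^{out}$ by rotation through $\pi$ in the plane orthogonal to $v^i,v^j$ from $N^{out}$ towards $v^{1,out}$. Lambda length from $(\mathfrak{h}_1,W_1)$ to $(\mathfrak{h}_2,W_2)$: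 it is $0$ if the centres coincide; otherwise let $\gamma$ be the oriented geodesic from the centre of $\mathfrak{h}_1$ to that of $\mathfrak{h}_2$, $p_m=\gamma\cap\mathfrak{h}_m$; translate $W_1^{in}(p_1)$ along $\gamma$ by signed distance $\rho$ to $p_2$, then rotate by angle $\theta\in\mathbb{R}/4\pi\mathbb{Z}$ in the 3-plane $\Pi\subset T_{p_2}\mathcal{H}^4$ orthogonal to $\gamma$ (oriented so that a basis of $\Pi$ followed by the tangent of $\gamma$ is positive; right-handed angle) about the oriented axis directed by a unit vector with coordinates $v\in\mathcal{V}$ w.r.t. the first three frame vectors identified with $1,i,j$, so as to reach $W_2^{out}(p_2)$. Then $\lambda_{12}=\exp\bigl((\rho+\theta vk)/2\bigr)\in\mathbb{H}$. *)

theory Defs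
  imports "HOL-Analysis.Analysis"
begin

definition mink :: "real^5 \<Rightarrow> real^5 \<Rightarrow> real" where
  "mink x y = x$0*y$0 - x$1*y$1 - x$2*y$2 - x$3*y$3 - x$4*y$4"

definition hyp :: "(real^5) set" where
  "hyp = {x. mink x x = 1 \<and> x$0 > 0}"

definition lightcone :: "(real^5) set" where
  "lightcone = {p. mink p p = 0 \<and> p$0 > 0}"

definition horosphere :: "real^5 \<Rightarrow> (real^5) set" where
  "horosphere p = {x \<in> hyp. mink x p = 1}"

definition same_centre :: "real^5 \<Rightarrow> real^5 \<Rightarrow> bool" where
  "same_centre p q \<longleftrightarrow> (\<exists>c>0. q = c *\<^sub>R p)"

type_synonym frame = "(real^5) \<times> (real^5) \<times> (real^5) \<times> (real^5) \<times> (real^5)"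

definition frame_mat :: "frame \<Rightarrow> real^5^5" where
  "frame_mat = (\<lambda>(x, f1, f2, f3, f4). (\<chi> i::5. if i = 0 then x else if i = 1 then f1
      else if i = 2 then f2 else if i = 3 then f3 else f4))"

text \<open>A point x of H^4 together with an oriented orthonormal frame (f1,f2,f3,f4) of
  T_x H^4.  Standard orientation: (f1,..,f4) is positive iff det[x;f1;..;f4] > 0
  (so (e1,e2,e3,e4) is positive at e0).\<close>
definition is_frame :: "frame \<Rightarrow> bool" where
  "is_frame F = (case F of (x, f1, f2, f3, f4) \<Rightarrow>
     x \<in> hyp \<and>
     (\<forall>i<4. mink ([f1,f2,f3,f4]!i) x = 0 \<and>
        (\<forall>j<4. mink ([f1,f2,f3,f4]!i) ([f1,f2,f3,f4]!j) = (if i = j then -1 else 0))) \<and>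
     det (frame_mat F) > 0)"

definition frames :: "frame set" where
  "frames = {F. is_frame F}"

definition base_frame :: frame where
  "base_frame = (axis 0 1, axis 1 1, axis 2 1, axis 3 1, axis 4 1)"

text \<open>Spin double cover of the (connected) oriented orthonormal frame bundle, realised
  as its universal cover: a spin frame is a homotopy class (rel endpoints, inside the
  frame bundle) of paths of frames starting at the base frame.\<close>
definition pclass :: "(real \<Rightarrow> frame) \<Rightarrow> (real \<Rightarrow> frame) set" where
  "pclass g = {g'. homotopic_paths frames g g'}"

definition spin_over :: "frame \<Rightarrow> (real \<Rightarrow> frame) set \<Rightarrow> bool" where
  "spin_over F S \<longleftrightarrow> (\<exists>g. path g \<and> path_image g \<subseteq> frames \<and> pathstart g = base_frame
       \<and> pathfinish g = F \<and> S = pclass g)"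

text \<open>A tangent vector field V on the horosphere of p is parallel (for the induced flat
  metric) iff along every differentiable curve in the horosphere its derivative is
  Minkowski-normal to the horosphere, i.e. lies in span{x, p}.\<close>
definition parallel_field :: "real^5 \<Rightarrow> (real^5 \<Rightarrow> real^5) \<Rightarrow> bool" where
  "parallel_field p V \<longleftrightarrow>
     (\<forall>\<alpha>::real \<Rightarrow> real^5. (\<forall>t. \<alpha> t \<in> horosphere p) \<and> (\<forall>t. \<alpha> differentiable at t) \<longrightarrow>
        (\<forall>t. \<exists>d. ((V \<circ> \<alpha>) has_vector_derivative d) (at t) \<and> d \<in> span {\<alpha> t, p}))"

definition decoration :: "real^5 \<Rightarrow> (real^5 \<Rightarrow> real^5) \<Rightarrow> (real^5 \<Rightarrow> real^5) \<Rightarrow> bool" where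
  "decoration p vi vj \<longleftrightarrow> p \<in> lightcone \<and>
     (\<forall>x\<in>horosphere p.
        mink (vi x) x = 0 \<and> mink (vi x) p = 0 \<and> mink (vj x) x = 0 \<and> mink (vj x) p = 0 \<and>
        mink (vi x) (vi x) = -1 \<and> mink (vj x) (vj x) = -1 \<and> mink (vi x) (vj x) = 0) \<and>
     parallel_field p vi \<and> parallel_field p vj"

text \<open>Inward normal points away from the centre, outward normal towards it.\<close>
definition N_in :: "real^5 \<Rightarrow> real^5 \<Rightarrow> real^5" where "N_in p x = x - p"
definition N_out :: "real^5 \<Rightarrow> real^5 \<Rightarrow> real^5" where "N_out p x = p - x"

definition v1_in where
  "v1_in p vi vj x = (THE v. is_frame (x, v, vi x, vj x, N_in p x))"
definition v1_out where
  "v1_out p vi vj x = (THE v. is_frame (x, v, vi x, vj x, N_out p x))"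

definition in_frame :: "real^5 \<Rightarrow> (real^5 \<Rightarrow> real^5) \<Rightarrow> (real^5 \<Rightarrow> real^5) \<Rightarrow> real^5 \<Rightarrow> frame" where
  "in_frame p vi vj x = (x, v1_in p vi vj x, vi x, vj x, N_in p x)"
definition out_frame :: "real^5 \<Rightarrow> (real^5 \<Rightarrow> real^5) \<Rightarrow> (real^5 \<Rightarrow> real^5) \<Rightarrow> real^5 \<Rightarrow> frame" where
  "out_frame p vi vj x = (x, v1_out p vi vj x, vi x, vj x, N_out p x)"

text \<open>Rotation through angle t*pi in the plane orthogonal to vi, vj, from N_out towards
  v1_out (t from 0 to 1): a path from the outward to the inward frame.\<close>
definition flip_path :: "real^5 \<Rightarrow> (real^5 \<Rightarrow> real^5) \<Rightarrow> (real^5 \<Rightarrow> real^5) \<Rightarrow> real^5 \<Rightarrow> real \<Rightarrow> frame" where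
  "flip_path p vi vj x t =
     (x, cos (t*pi) *\<^sub>R v1_out p vi vj x - sin (t*pi) *\<^sub>R N_out p x, vi x, vj x,
         cos (t*pi) *\<^sub>R N_out p x + sin (t*pi) *\<^sub>R v1_out p vi vj x)"

record sdh =
  hpt :: "real^5"
  hvi :: "real^5 \<Rightarrow> real^5"
  hvj :: "real^5 \<Rightarrow> real^5"
  Win :: "real^5 \<Rightarrow> (real \<Rightarrow> frame) set"
  Wout :: "real^5 \<Rightarrow> (real \<Rightarrow> frame) set"

text \<open>Spin-decorated horosphere.  Continuity of the lifts is expressed by path lifting:
  along any path in the horosphere the lift is obtained by continuing the path class by
  the frame field along that path.\<close>
definition spin_decorated :: "sdh \<Rightarrow> bool" where
  "spin_decorated S \<longleftrightarrow>
    (let p = hpt S; vi = hvi S; vj = hvj S; h = horosphere p in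
     decoration p vi vj \<and>
     (\<forall>x\<in>h. spin_over (out_frame p vi vj x) (Wout S x) \<and> spin_over (in_frame p vi vj x) (Win S x)) \<and>
     (\<forall>x y \<alpha>. path \<alpha> \<and> path_image \<alpha> \<subseteq> h \<and> pathstart \<alpha> = x \<and> pathfinish \<alpha> = y \<longrightarrow>
        (\<forall>g\<in>Wout S x. g +++ (out_frame p vi vj \<circ> \<alpha>) \<in> Wout S y) \<and>
        (\<forall>g\<in>Win S x. g +++ (in_frame p vi vj \<circ> \<alpha>) \<in> Win S y)) \<and>
     (\<forall>x\<in>h. \<forall>g\<in>Wout S x. g +++ flip_path p vi vj x \<in> Win S x))"

datatype quat = Quat real real real real

fun qadd :: "quat \<Rightarrow> quat \<Rightarrow> quat" where
  "qadd (Quat a b c d) (Quat a' b' c' d') = Quat (a+a') (b+b') (c+c') (d+d')"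

fun qmult :: "quat \<Rightarrow> quat \<Rightarrow> quat" where
  "qmult (Quat a1 b1 c1 d1) (Quat a2 b2 c2 d2) =
     Quat (a1*a2 - b1*b2 - c1*c2 - d1*d2)
          (a1*b2 + b1*a2 + c1*d2 - d1*c2)
          (a1*c2 - b1*d2 + c1*a2 + d1*b2)
          (a1*d2 + b1*c2 - c1*b2 + d1*a2)"

fun qinv :: "quat \<Rightarrow> quat" where
  "qinv (Quat a b c d) = (let n = a^2 + b^2 + c^2 + d^2 in
      Quat (a/n) (-b/n) (-c/n) (-d/n))"

definition qone :: quat where "qone = Quat 1 0 0 0"
definition qzero :: quat where "qzero = Quat 0 0 0 0"

fun qexp :: "quat \<Rightarrow> quat" where
  "qexp (Quat a b c d) = (let r = sqrt (b^2 + c^2 + d^2) in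
      Quat (exp a * cos r) (exp a * sin r / r * b) (exp a * sin r / r * c) (exp a * sin r / r * d))"

text \<open>Oriented geodesic from the centre of horosphere(c1) to that of horosphere(c2) is
  {a c1 + b c2 | a, b > 0} inside H^4; foot c1 c2 is its intersection with horosphere c1,
  gtan c1 c2 x the unit tangent at x pointing towards the centre of horosphere c2.\<close>
definition foot :: "real^5 \<Rightarrow> real^5 \<Rightarrow> real^5" where
  "foot c1 c2 = (THE x. x \<in> horosphere c1 \<and> (\<exists>a b. a > 0 \<and> b > 0 \<and> x = a *\<^sub>R c1 + b *\<^sub>R c2))"

definition gtan :: "real^5 \<Rightarrow> real^5 \<Rightarrow> real^5 \<Rightarrow> real^5" where
  "gtan c1 c2 x = (THE T. mink T x = 0 \<and> mink T T = -1 \<and> (\<exists>a b. b > 0 \<and> T = a *\<^sub>R c1 + b *\<^sub>R c2))"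

text \<open>Translation (boost) by signed distance s along the geodesic through x with unit
  tangent T, as a linear map of R^{1,4}, applied to all vectors of a frame.\<close>
definition boostv :: "real^5 \<Rightarrow> real^5 \<Rightarrow> real \<Rightarrow> real^5 \<Rightarrow> real^5" where
  "boostv x T s y = (let a = mink y x; b = - mink y T in
     a *\<^sub>R (cosh s *\<^sub>R x + sinh s *\<^sub>R T) + b *\<^sub>R (sinh s *\<^sub>R x + cosh s *\<^sub>R T) + (y - a *\<^sub>R x - b *\<^sub>R T))"

definition boost_frame :: "real^5 \<Rightarrow> real^5 \<Rightarrow> real \<Rightarrow> frame \<Rightarrow> frame" where
  "boost_frame x T s F = (case F of (q, f1, f2, f3, f4) \<Rightarrow>
     (boostv x T s q, boostv x T s f1, boostv x T s f2, boostv x T s f3, boostv x T s f4))"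

text \<open>Right-handed rotation by angle phi about the unit axis with coordinates a (w.r.t. the
  positive orthonormal basis e1,e2,e3 of the 3-plane Pi), fixing Pi's orthogonal complement.\<close>
definition rotv :: "real^5 \<Rightarrow> real^5 \<Rightarrow> real^5 \<Rightarrow> real^3 \<Rightarrow> real \<Rightarrow> real^5 \<Rightarrow> real^5" where
  "rotv e1 e2 e3 a phi y = (let
     c = (vector [- mink y e1, - mink y e2, - mink y e3] :: real^3);
     c' = cos phi *\<^sub>R c + sin phi *\<^sub>R cross3 a c + ((1 - cos phi) * (a \<bullet> c)) *\<^sub>R a
   in y - (c$1 *\<^sub>R e1 + c$2 *\<^sub>R e2 + c$3 *\<^sub>R e3) + (c'$1 *\<^sub>R e1 + c'$2 *\<^sub>R e2 + c'$3 *\<^sub>R e3))"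

text \<open>Rotation of a frame (q,e1,e2,e3,e4) in the plane Pi = span{e1,e2,e3} orthogonal to
  the geodesic direction e4.\<close>
definition rot_frame :: "real^3 \<Rightarrow> real \<Rightarrow> frame \<Rightarrow> frame" where
  "rot_frame a phi F = (case F of (q, e1, e2, e3, e4) \<Rightarrow>
     (rotv e1 e2 e3 a phi q, rotv e1 e2 e3 a phi e1, rotv e1 e2 e3 a phi e2,
      rotv e1 e2 e3 a phi e3, rotv e1 e2 e3 a phi e4))"

text \<open>Lambda length from S1 to S2: lambda = exp((rho + theta v k)/2), where v = (v1,v2,v3)
  are the coordinates w.r.t. 1,i,j, so v k = v1 k - v2 j + v3 i.  The spin condition
  says: continuing a path representing W1_in(p1) by the translation path (distance t*rho)
  and then the rotation path (angle t*theta) yields a representative of W2_out(p2).\<close>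
definition lam :: "sdh \<Rightarrow> sdh \<Rightarrow> quat" where
  "lam S1 S2 = (let c1 = hpt S1; c2 = hpt S2 in
     if same_centre c1 c2 then qzero else
     (SOME q. \<exists>\<rho> \<theta> (v::real^3). norm v = 1 \<and>
        (let x1 = foot c1 c2; x2 = foot c2 c1; T = gtan c1 c2 x1;
             F1 = in_frame c1 (hvi S1) (hvj S1) x1;
             tr = (\<lambda>t. boost_frame x1 T (t * \<rho>) F1);
             rp = (\<lambda>t. rot_frame v (t * \<theta>) (tr 1))
         in fst (tr 1) = x2 \<and> (\<exists>g\<in>Win S1 x1. pclass (g +++ tr +++ rp) = Wout S2 x2)) \<and>
        q = qexp (Quat (\<rho>/2) (\<theta> * v$3 / 2) (- \<theta> * v$2 / 2) (\<theta> * v$1 / 2))))"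

end

theory Submission
  imports Defs
begin

text \<open>Write Minkowski space as the Hermitian quaternionic matrices with equal diagonal entries, so that
  \<open>Sp(1,1)\<close> acts on it by \<open>x \<mapsto> A x A*\<close>. Applying \<open>A\<close> to the base frame makes \<open>Sp(1,1)\<close> a double cover
  of the frame bundle, and by the polar decomposition \<open>Sp(1,1)\<close> is homeomorphic to the product of a
  4-space and two 3-spheres, hence simply connected. So homotopy classes of frame paths are the elements
  of \<open>Sp(1,1)\<close>. Along a horosphere the parallel frames differ by unipotent right factors, which fix the
  vector \<open>(1,1)\<close>; a spin decoration therefore determines a spinor \<open>\<kappa> = A (1,1)\<close>. Translating and rotating
  along a geodesic multiplies \<open>A (1,1)\<close> on the right by the lambda length, so \<open>\<lambda>\<close> is, up to a constant left
  factor, the value of the invariant sesquilinear form on the two spinors. The relation is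
  the expansion of one isotropic spinor in the basis given by two others.\<close>

section \<open>Quaternions as a normed division algebra\<close>

text \<open>The spin data are path classes and \<open>lam\<close> is a \<open>SOME\<close> over
  existential parameters, so nothing can be computed until each class is named by one matrix.
  Starting every lift at \<open>mat 1\<close> does this and leaves no sign to choose. Each
  continuation of a path in the definitions then becomes a right multiplication: by a unipotent
  element along a horosphere, by diag(k, -k) for the half turn from outward to inward frames, by a
  translation and a rotation along a geodesic. Inward frames are read through (1,-1) instead of
  (1,1). The half turn sends (1,-1) to (1,1) k, and (1,-1) pairs with (1,1) to 2, which is the
  origin of the constant left factor conj(k)/2 in lambda. In the relation, lambda lengths occur in
  adjacent pairs \<open>inverse lambda * lambda'\<close>, so this factor cancels although
  quaternions do not commute. Coincident centres fit in as well: proportional null vectors have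
  isotropic spinors of pairing 0, which agrees with the value 0 prescribed for lambda.\<close>

primrec qRe :: "quat \<Rightarrow> real" where "qRe (Quat a b c d) = a"
primrec qI :: "quat \<Rightarrow> real" where "qI (Quat a b c d) = b"
primrec qJ :: "quat \<Rightarrow> real" where "qJ (Quat a b c d) = c"
primrec qK :: "quat \<Rightarrow> real" where "qK (Quat a b c d) = d"

lemma quat_eq_iff: "x = y \<longleftrightarrow> qRe x = qRe y \<and> qI x = qI y \<and> qJ x = qJ y \<and> qK x = qK y"
  by (cases x; cases y) auto

instantiation quat :: ab_group_add
begin
definition "0 = qzero"
definition "x + y = qadd x y"
definition "- x = Quat (- qRe x) (- qI x) (- qJ x) (- qK x)"
definition "x - y = Quat (qRe x - qRe y) (qI x - qI y) (qJ x - qJ y) (qK x - qK y)"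

lemma quat_zero_sel [simp]:
  "qRe 0 = 0" "qI 0 = 0" "qJ 0 = 0" "qK 0 = 0"
  by (simp_all add: zero_quat_def qzero_def)

lemma quat_add_sel [simp]:
  "qRe (x + y) = qRe x + qRe y" "qI (x + y) = qI x + qI y"
  "qJ (x + y) = qJ x + qJ y" "qK (x + y) = qK x + qK y"
  by (cases x; cases y; simp add: plus_quat_def)+

lemma quat_uminus_sel [simp]:
  "qRe (- x) = - qRe x" "qI (- x) = - qI x" "qJ (- x) = - qJ x" "qK (- x) = - qK x"
  by (simp_all add: uminus_quat_def)

lemma quat_minus_sel [simp]:
  "qRe (x - y) = qRe x - qRe y" "qI (x - y) = qI x - qI y"
  "qJ (x - y) = qJ x - qJ y" "qK (x - y) = qK x - qK y"
  by (simp_all add: minus_quat_def)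

instance by standard (simp_all add: quat_eq_iff)
end

instantiation quat :: real_vector
begin
definition "scaleR r x = Quat (r * qRe x) (r * qI x) (r * qJ x) (r * qK x)"

lemma quat_scaleR_sel [simp]:
  "qRe (r *\<^sub>R x) = r * qRe x" "qI (r *\<^sub>R x) = r * qI x"
  "qJ (r *\<^sub>R x) = r * qJ x" "qK (r *\<^sub>R x) = r * qK x"
  by (simp_all add: scaleR_quat_def)

instance by standard (simp_all add: quat_eq_iff algebra_simps)
end

instantiation quat :: real_algebra_1
begin
definition "1 = qone"
definition "x * y = qmult x y"

lemma quat_one_sel [simp]:
  "qRe 1 = 1" "qI 1 = 0" "qJ 1 = 0" "qK 1 = 0"
  by (simp_all add: one_quat_def qone_def)

lemma quat_mult_sel [simp]:
  "qRe (x * y) = qRe x * qRe y - qI x * qI y - qJ x * qJ y - qK x * qK y"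
  "qI (x * y) = qRe x * qI y + qI x * qRe y + qJ x * qK y - qK x * qJ y"
  "qJ (x * y) = qRe x * qJ y - qI x * qK y + qJ x * qRe y + qK x * qI y"
  "qK (x * y) = qRe x * qK y + qI x * qJ y - qJ x * qI y + qK x * qRe y"
  by (cases x; cases y; simp add: times_quat_def)+

instance by standard (simp_all add: quat_eq_iff algebra_simps)
end

lemma quat_of_real_sel [simp]:
  "qRe (of_real r) = r" "qI (of_real r) = 0" "qJ (of_real r) = 0" "qK (of_real r) = 0"
  by (simp_all add: of_real_def)

lemma quat_numeral_sel [simp]:
  "qRe (numeral n) = numeral n" "qI (numeral n) = 0" "qJ (numeral n) = 0" "qK (numeral n) = 0"
  using quat_of_real_sel[of "numeral n"] by (simp_all only: of_real_numeral)

instantiation quat :: real_inner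
begin
definition "inner x y = qRe x * qRe y + qI x * qI y + qJ x * qJ y + qK x * qK y" for x y :: quat
definition "norm x = sqrt (inner x x)" for x :: quat
definition "dist x y = norm (x - y)" for x y :: quat
definition "sgn x = x /\<^sub>R norm x" for x :: quat
definition [code del]: "(uniformity :: (quat \<times> quat) filter) = (INF e\<in>{0<..}. principal {(x, y). dist x y < e})"
definition [code del]: "open (U :: quat set) \<longleftrightarrow> (\<forall>x\<in>U. eventually (\<lambda>(x', y). x' = x \<longrightarrow> y \<in> U) uniformity)"
instance
proof
  fix x y z :: quat and r :: real
  show "inner x y = inner y x" "inner (x + y) z = inner x z + inner y z"
    "inner (r *\<^sub>R x) y = r * inner x y"
    by (simp_all add: inner_quat_def algebra_simps)
  show "0 \<le> inner x x" by (simp add: inner_quat_def)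
  have sq: "a * a + b * b + c * c + d * d = 0 \<longleftrightarrow> a = 0 \<and> b = 0 \<and> c = 0 \<and> d = 0" for a b c d :: real
    using sum_squares_eq_zero_iff[of a b] sum_squares_eq_zero_iff[of c d]
      sum_squares_ge_zero[of a b] sum_squares_ge_zero[of c d] by (smt (verit) zero_le_square)
  show "inner x x = 0 \<longleftrightarrow> x = 0"
    by (simp only: inner_quat_def sq) (simp add: quat_eq_iff)
qed (simp_all add: norm_quat_def dist_quat_def sgn_quat_def uniformity_quat_def open_quat_def)
end

lemma norm_quat_sq: "(norm x)\<^sup>2 = qRe x * qRe x + qI x * qI x + qJ x * qJ x + qK x * qK x"
  for x :: quat
  by (simp add: norm_quat_def inner_quat_def)

instantiation quat :: real_normed_div_algebra
begin
definition "inverse x = qinv x"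
definition "x div y = x * inverse y" for x y :: quat

lemma quat_inverse_sel:
  "qRe (inverse x) = qRe x / (norm x)\<^sup>2" "qI (inverse x) = - qI x / (norm x)\<^sup>2"
  "qJ (inverse x) = - qJ x / (norm x)\<^sup>2" "qK (inverse x) = - qK x / (norm x)\<^sup>2"
  by (cases x; simp only: norm_quat_sq inverse_quat_def qinv.simps Let_def; simp add: power2_eq_square)+

instance
proof
  fix x y :: quat
  show "x div y = x * inverse y" by (simp add: divide_quat_def)
  show "inverse (0 :: quat) = 0" by (simp add: quat_eq_iff quat_inverse_sel)
  have *: "(norm x)\<^sup>2 \<noteq> 0" if "x \<noteq> 0" for x :: quat using that by simp
  have **: "a * a / n + b * b / n + c * c / n + d * d / n = 1"
    if "n = a * a + b * b + c * c + d * d" "n \<noteq> 0" for a b c d n :: real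
    unfolding add_divide_distrib[symmetric] that(1)[symmetric] using that(2) by simp
  assume "x \<noteq> 0"
  note h = *[OF this] and nn = norm_quat_sq[of x]
  show "inverse x * x = 1" "x * inverse x = 1"
    using **[OF nn h] by (simp_all add: quat_eq_iff quat_inverse_sel mult.commute)
next
  fix x y :: quat
  have "(norm (x * y))\<^sup>2 = (norm x * norm y)\<^sup>2"
    by (simp add: norm_quat_sq power_mult_distrib algebra_simps)
  then show "norm (x * y) = norm x * norm y"
    by (simp add: power2_eq_iff_nonneg)
qed
end

abbreviation "qi \<equiv> Quat 0 1 0 0"
abbreviation "qj \<equiv> Quat 0 0 1 0"
abbreviation "qk \<equiv> Quat 0 0 0 1"

instantiation quat :: euclidean_space
begin
definition "Basis = {1, qi, qj, qk}"
instance
proof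
  show "(Basis :: quat set) \<noteq> {}" "finite (Basis :: quat set)"
    by (simp_all add: Basis_quat_def)
  show "inner u v = (if u = v then 1 else 0)" if "u \<in> Basis" "v \<in> Basis" for u v :: quat
    using that by (auto simp: Basis_quat_def inner_quat_def quat_eq_iff)
  show "(\<forall>u\<in>Basis. inner x u = 0) \<longleftrightarrow> x = 0" for x :: quat
    by (simp add: Basis_quat_def) (simp add: inner_quat_def quat_eq_iff)
qed
end

text \<open>The dimension is what makes the sphere of unit quaternions simply connected:
  \<open>simply_connected_sphere\<close> asks for at least 3.\<close>

lemma DIM_quat [simp]: "DIM(quat) = 4"
  by (simp add: Basis_quat_def quat_eq_iff)

definition qcnj :: "quat \<Rightarrow> quat" where
  "qcnj x = Quat (qRe x) (- qI x) (- qJ x) (- qK x)"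

lemma qcnj_sel [simp]:
  "qRe (qcnj x) = qRe x" "qI (qcnj x) = - qI x" "qJ (qcnj x) = - qJ x" "qK (qcnj x) = - qK x"
  by (simp_all add: qcnj_def)

lemma qcnj_simps [simp]:
  "qcnj (qcnj x) = x" "qcnj 0 = 0" "qcnj 1 = 1" "qcnj (of_real r) = of_real r"
  "qcnj (x + y) = qcnj x + qcnj y" "qcnj (x - y) = qcnj x - qcnj y" "qcnj (- x) = - qcnj x"
  "qcnj (r *\<^sub>R x) = r *\<^sub>R qcnj x" "qcnj (x * y) = qcnj y * qcnj x"
  by (simp_all add: quat_eq_iff)

lemma qcnj_eq_iff [simp]: "qcnj x = qcnj y \<longleftrightarrow> x = y"
  by (auto simp: quat_eq_iff)

lemma norm_qcnj [simp]: "norm (qcnj x) = norm x"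
  by (simp add: norm_quat_def inner_quat_def)

lemma mult_qcnj: "x * qcnj x = of_real ((norm x)\<^sup>2)" "qcnj x * x = of_real ((norm x)\<^sup>2)"
  by (simp_all add: quat_eq_iff norm_quat_sq algebra_simps)

lemma mult_qcnj_unit [simp]:
  assumes "norm x = 1" shows "x * qcnj x = 1" "qcnj x * x = 1"
  using assms by (simp_all add: mult_qcnj)

lemma bounded_linear_quat_sel:
  "bounded_linear qRe" "bounded_linear qI" "bounded_linear qJ" "bounded_linear qK" "bounded_linear qcnj"
  by (rule linear_conv_bounded_linear[THEN iffD1], rule linearI, simp_all)+

lemmas continuous_on_quat_sel [continuous_intros] =
  bounded_linear_quat_sel[THEN bounded_linear.continuous_on]

lemma continuous_on_Quat [continuous_intros]:
  assumes "continuous_on S a" "continuous_on S b" "continuous_on S c" "continuous_on S d"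
  shows "continuous_on S (\<lambda>x. Quat (a x) (b x) (c x) (d x))"
proof -
  have "Quat a b c d = a *\<^sub>R 1 + b *\<^sub>R qi + c *\<^sub>R qj + d *\<^sub>R qk" for a b c d
    by (simp add: quat_eq_iff)
  then have "(\<lambda>x. Quat (a x) (b x) (c x) (d x)) = (\<lambda>x. a x *\<^sub>R 1 + b x *\<^sub>R qi + c x *\<^sub>R qj + d x *\<^sub>R qk)"
    by (rule ext)
  then show ?thesis by (simp only:) (intro continuous_intros assms)
qed

section \<open>The group Sp(1,1) acting on Minkowski space\<close>

lemma exhaust_5: "x = 0 \<or> x = 1 \<or> x = 2 \<or> x = 3 \<or> x = 4" for x :: 5
proof (induct x)
  case (of_int z)
  then have "0 \<le> z" "z < 5" by simp_all
  then have "z = 0 \<or> z = 1 \<or> z = 2 \<or> z = 3 \<or> z = 4" by arith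
  then show ?case by auto
qed

lemma forall_5: "(\<forall>i::5. P i) \<longleftrightarrow> P 0 \<and> P 1 \<and> P 2 \<and> P 3 \<and> P 4"
  by (metis exhaust_5)

lemma UNIV_5: "(UNIV :: 5 set) = {0, 1, 2, 3, 4}"
  using exhaust_5 by auto

lemma sum_5: "sum f (UNIV :: 5 set) = f 0 + f 1 + f 2 + f 3 + f 4"
proof -
  have "sum f {0, 1, 2, 3, 4::5} = f 0 + (f 1 + (f 2 + (f 3 + f 4)))" by simp
  then show ?thesis by (simp only: UNIV_5 add.assoc)
qed

definition vec5 :: "real \<Rightarrow> real \<Rightarrow> real \<Rightarrow> real \<Rightarrow> real \<Rightarrow> real^5" where
  "vec5 a b c d e = (\<chi> i. if i = 0 then a else if i = 1 then b else if i = 2 then c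
    else if i = 3 then d else e)"

lemma vec5_sel [simp]:
  "vec5 a b c d e $ 0 = a" "vec5 a b c d e $ 1 = b" "vec5 a b c d e $ 2 = c"
  "vec5 a b c d e $ 3 = d" "vec5 a b c d e $ 4 = e"
  by (simp_all add: vec5_def)

lemma vec5_eq_iff: "x = y \<longleftrightarrow> x$0 = y$0 \<and> x$1 = y$1 \<and> x$2 = y$2 \<and> x$3 = y$3 \<and> x$4 = y$4"
  for x y :: "'a^5"
  by (simp add: vec_eq_iff forall_5)

definition mat2 :: "quat \<Rightarrow> quat \<Rightarrow> quat \<Rightarrow> quat \<Rightarrow> quat^2^2" where
  "mat2 a b c d = (\<chi> i j. if i = 1 then if j = 1 then a else b else if j = 1 then c else d)"

lemma mat2_sel [simp]:
  "mat2 a b c d $ 1 $ 1 = a" "mat2 a b c d $ 1 $ 2 = b"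
  "mat2 a b c d $ 2 $ 1 = c" "mat2 a b c d $ 2 $ 2 = d"
  by (simp_all add: mat2_def)

lemma mat2_eq_iff: "A = B \<longleftrightarrow> A$1$1 = B$1$1 \<and> A$1$2 = B$1$2 \<and> A$2$1 = B$2$1 \<and> A$2$2 = B$2$2"
  for A B :: "'a^2^2"
  by (simp add: vec_eq_iff forall_2)

lemma mat2_cases:
  obtains a b c d where "A = mat2 a b c d"
proof
  show "A = mat2 (A$1$1) (A$1$2) (A$2$1) (A$2$2)"
    by (simp add: mat2_eq_iff)
qed

lemma mat2_arith:
  "mat2 a b c d + mat2 a' b' c' d' = mat2 (a + a') (b + b') (c + c') (d + d')"
  "mat2 a b c d - mat2 a' b' c' d' = mat2 (a - a') (b - b') (c - c') (d - d')"
  "r *\<^sub>R mat2 a b c d = mat2 (r *\<^sub>R a) (r *\<^sub>R b) (r *\<^sub>R c) (r *\<^sub>R d)"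
  "mat2 a b c d ** mat2 a' b' c' d' =
     mat2 (a * a' + b * c') (a * b' + b * d') (c * a' + d * c') (c * b' + d * d')"
  "mat 1 = mat2 1 0 0 1"
  by (simp_all add: mat2_eq_iff matrix_matrix_mult_def sum_2 mat_def)

lemma mat2_eq_mat2 [simp]:
  "mat2 a b c d = mat2 a' b' c' d' \<longleftrightarrow> a = a' \<and> b = b' \<and> c = c' \<and> d = d'"
  by (simp add: mat2_eq_iff)

definition madj :: "quat^2^2 \<Rightarrow> quat^2^2" where
  "madj A = (\<chi> i j. qcnj (A$j$i))"

lemma madj_mat2 [simp]: "madj (mat2 a b c d) = mat2 (qcnj a) (qcnj c) (qcnj b) (qcnj d)"
  by (simp add: madj_def mat2_eq_iff)

lemma madj_simps [simp]:
  "madj (madj A) = A" "madj (A ** B) = madj B ** madj A" "madj (A + B) = madj A + madj B"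
  "madj (mat 1) = mat 1" "madj (r *\<^sub>R A) = r *\<^sub>R madj A"
  by (cases A rule: mat2_cases; cases B rule: mat2_cases; simp add: mat2_arith)+

lemma matrix_scaleR_mult:
  "(r *\<^sub>R A) ** B = r *\<^sub>R (A ** B)" "A ** (r *\<^sub>R B) = r *\<^sub>R (A ** B)" for A B :: "quat^2^2"
  by (cases A rule: mat2_cases; cases B rule: mat2_cases; simp add: mat2_arith scaleR_add_right)+

lemma matrix_add_rdistrib_quat: "(A + B) ** C = A ** C + B ** C" for A B C :: "quat^2^2"
  by (cases A rule: mat2_cases; cases B rule: mat2_cases; cases C rule: mat2_cases)
    (simp add: mat2_arith algebra_simps)

section \<open>The Hermitian form of signature (1,1) and its isometry group\<close>

definition Kmat :: "quat^2^2" where "Kmat = mat2 1 0 0 (- 1)"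

lemma madj_Kmat [simp]: "madj Kmat = Kmat" and Kmat_Kmat [simp]: "Kmat ** Kmat = mat 1"
  by (simp_all add: Kmat_def mat2_arith)

text \<open>The isometries of the form \<open>Kmat\<close>. The two identities yield the two sides
  of the inverse \<open>ginv\<close>, and in terms of entries they relate the columns and the rows
  of A.\<close>

definition Sp11 :: "(quat^2^2) set" where
  "Sp11 = {A. madj A ** Kmat ** A = Kmat \<and> A ** Kmat ** madj A = Kmat}"

definition ginv :: "quat^2^2 \<Rightarrow> quat^2^2" where "ginv A = Kmat ** madj A ** Kmat"

lemma Sp11_one [simp]: "mat 1 \<in> Sp11"
  by (simp add: Sp11_def)

lemma Sp11_mult [simp]:
  assumes "A \<in> Sp11" "B \<in> Sp11" shows "A ** B \<in> Sp11"
proof -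
  have "madj B ** (madj A ** Kmat ** A) ** B = Kmat" "A ** (B ** Kmat ** madj B) ** madj A = Kmat"
    using assms by (simp_all add: Sp11_def)
  then show ?thesis by (simp add: Sp11_def matrix_mul_assoc)
qed

lemma Sp11_ginv [simp]:
  assumes "A \<in> Sp11" shows "ginv A \<in> Sp11"
proof -
  have "A ** Kmat ** madj A = Kmat" "madj A ** Kmat ** A = Kmat"
    using assms by (simp_all add: Sp11_def)
  moreover have "Kmat ** A ** Kmat ** Kmat ** (Kmat ** madj A ** Kmat)
      = Kmat ** (A ** (Kmat ** Kmat) ** Kmat ** madj A) ** Kmat"
    "Kmat ** madj A ** Kmat ** Kmat ** (Kmat ** A ** Kmat)
      = Kmat ** (madj A ** (Kmat ** Kmat) ** Kmat ** A) ** Kmat"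
    by (simp_all only: matrix_mul_assoc)
  ultimately show ?thesis
    by (simp add: Sp11_def ginv_def matrix_mul_assoc)
qed

lemma ginv_mult [simp]:
  assumes "A \<in> Sp11" shows "A ** ginv A = mat 1" "ginv A ** A = mat 1"
proof -
  have "A ** Kmat ** madj A = Kmat" "madj A ** Kmat ** A = Kmat"
    using assms by (simp_all add: Sp11_def)
  moreover have "A ** ginv A = (A ** Kmat ** madj A) ** Kmat"
    "ginv A ** A = Kmat ** (madj A ** Kmat ** A)"
    by (simp_all add: ginv_def matrix_mul_assoc)
  ultimately show "A ** ginv A = mat 1" "ginv A ** A = mat 1" by simp_all
qed

lemma ginv_mult_cancel [simp]:
  assumes "A \<in> Sp11" shows "A ** (ginv A ** B) = B" "ginv A ** (A ** B) = B"
  using assms by (simp_all add: matrix_mul_assoc)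

lemma mat2_in_Sp11:
  "mat2 a b c d \<in> Sp11 \<longleftrightarrow>
     qcnj a * a - qcnj c * c = 1 \<and> qcnj a * b = qcnj c * d \<and> qcnj b * b - qcnj d * d = - 1 \<and>
     a * qcnj a - b * qcnj b = 1 \<and> a * qcnj c = b * qcnj d \<and> c * qcnj c - d * qcnj d = - 1"
proof -
  have "qcnj b * a = qcnj d * c \<longleftrightarrow> qcnj a * b = qcnj c * d" for a b c d
    using qcnj_eq_iff[of "qcnj b * a" "qcnj d * c"] by simp
  moreover have "c * qcnj a = d * qcnj b \<longleftrightarrow> a * qcnj c = b * qcnj d" for a b c d
    using qcnj_eq_iff[of "c * qcnj a" "d * qcnj b"] by simp
  ultimately show ?thesis
    by (auto simp: Sp11_def Kmat_def mat2_arith)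
qed

text \<open>The identification of \<open>span {e1, e2, e3}\<close> with the imaginary quaternions is chosen such that
  the paravector \<open>v = v1 + v2 i + v3 j\<close> of an axis corresponds to \<open>v k = v1 k - v2 j + v3 i\<close>.\<close>

definition wq :: "real^5 \<Rightarrow> quat" where "wq x = Quat (x$4) (x$3) (- (x$2)) (x$1)"

definition herm :: "real^5 \<Rightarrow> quat^2^2" where
  "herm x = mat2 (of_real (x$0)) (wq x) (qcnj (wq x)) (of_real (x$0))"

definition unherm :: "quat^2^2 \<Rightarrow> real^5" where
  "unherm S = vec5 (qRe (S$1$1)) (qK (S$1$2)) (- qJ (S$1$2)) (qI (S$1$2)) (qRe (S$1$2))"

lemma wq_sel [simp]: "qRe (wq x) = x$4" "qI (wq x) = x$3" "qJ (wq x) = - (x$2)" "qK (wq x) = x$1"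
  by (simp_all add: wq_def)

lemma unherm_herm [simp]: "unherm (herm x) = x"
  by (simp add: unherm_def herm_def vec5_eq_iff)

lemma herm_inject [simp]: "herm x = herm y \<longleftrightarrow> x = y"
  by (metis unherm_herm)

lemma herm_unherm:
  "herm (unherm (mat2 s w (qcnj w) s)) = mat2 s w (qcnj w) s" if "qcnj s = s"
  using that by (simp add: unherm_def herm_def quat_eq_iff)

lemma herm_simps [simp]:
  "herm (x + y) = herm x + herm y" "herm (x - y) = herm x - herm y"
  "herm (r *\<^sub>R x) = r *\<^sub>R herm x" "madj (herm x) = herm x"
  by (simp_all add: herm_def mat2_arith quat_eq_iff)

lemma unherm_simps [simp]:
  "unherm (x + y) = unherm x + unherm y" "unherm (r *\<^sub>R x) = r *\<^sub>R unherm x"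
  by (simp_all add: unherm_def vec5_eq_iff)

lemma herm_axis:
  "herm (axis 0 1) = mat 1" "herm (axis 1 1) = mat2 0 qk (- qk) 0"
  "herm (axis 2 1) = mat2 0 (- qj) qj 0" "herm (axis 3 1) = mat2 0 qi (- qi) 0"
  "herm (axis 4 1) = mat2 0 1 1 0"
  by (simp_all add: herm_def mat2_arith quat_eq_iff axis_def)

text \<open>A Clifford relation. It reads the Minkowski form off a symmetrised product, so
  preserving \<open>Kmat\<close> implies preserving \<open>mink\<close>, and no quaternionic
  determinant has to be defined.\<close>

lemma herm_Kmat_herm:
  "herm x ** Kmat ** herm y + herm y ** Kmat ** herm x = (2 * mink x y) *\<^sub>R Kmat"
  by (simp add: herm_def Kmat_def mat2_arith quat_eq_iff mink_def algebra_simps)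

definition act :: "quat^2^2 \<Rightarrow> real^5 \<Rightarrow> real^5" where
  "act A x = unherm (A ** herm x ** madj A)"

text \<open>\<open>unherm\<close> reads only some entries, so the point is that the transformed
  matrix again has equal real diagonal entries. Both are controlled by the columns of A: the
  coefficients of t agree because |a|^2 + |b|^2 = |c|^2 + |d|^2, and those of w because conj(b) a =
  conj(d) c.\<close>

lemma herm_act:
  assumes "A \<in> Sp11"
  shows "herm (act A x) = A ** herm x ** madj A"
proof (cases A rule: mat2_cases)
  case (1 a b c d)
  note G = assms[unfolded 1 mat2_in_Sp11]
  define t w where "t = x$0" and "w = wq x"
  have tc: "of_real t * q = q * of_real t" for q :: quat
    by (simp add: quat_eq_iff algebra_simps)
  define s where "s = (a * of_real t + b * qcnj w) * qcnj a + (a * w + b * of_real t) * qcnj b"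
  define s' where "s' = (c * of_real t + d * qcnj w) * qcnj c + (c * w + d * of_real t) * qcnj d"
  define u where "u = (a * of_real t + b * qcnj w) * qcnj c + (a * w + b * of_real t) * qcnj d"
  have eq: "A ** herm x ** madj A = mat2 s u (qcnj u) s'"
    by (simp add: herm_def 1 mat2_arith s_def s'_def u_def t_def w_def algebra_simps
        tc[unfolded t_def])
  have n: "norm a ^ 2 - norm c ^ 2 = 1" "norm b ^ 2 - norm d ^ 2 = - 1" "norm a ^ 2 - norm b ^ 2 = 1"
    using G by (simp_all add: norm_quat_sq quat_eq_iff)
  have qs: "qcnj s = s" "qcnj s' = s'"
    by (simp_all add: s_def s'_def algebra_simps tc)
  have "qRe s = t * (norm a ^ 2 + norm b ^ 2) + 2 * qRe (qcnj b * a * w)"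
    by (simp add: s_def norm_quat_sq algebra_simps)
  also have "\<dots> = t * (norm c ^ 2 + norm d ^ 2) + 2 * qRe (qcnj d * c * w)"
  proof -
    have "qcnj b * a = qcnj d * c"
      using G qcnj_eq_iff[of "qcnj b * a" "qcnj d * c"] by simp
    then show ?thesis using n by simp
  qed
  also have "\<dots> = qRe s'"
    by (simp add: s'_def norm_quat_sq algebra_simps)
  finally have "s = s'" using qs by (simp add: quat_eq_iff)
  with eq qs show ?thesis by (simp add: act_def herm_unherm)
qed

lemma act_mult [simp]:
  assumes "A \<in> Sp11" "B \<in> Sp11" shows "act (A ** B) x = act A (act B x)"
proof -
  have "herm (act (A ** B) x) = herm (act A (act B x))"
    using assms by (simp add: herm_act matrix_mul_assoc)
  then show ?thesis by simp
qed

lemma act_one [simp]: "act (mat 1) x = x"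
  by (simp add: act_def)

lemma act_ginv [simp]:
  assumes "A \<in> Sp11" shows "act A (act (ginv A) x) = x" "act (ginv A) (act A x) = x"
  using assms by (simp_all flip: act_mult)

lemma act_linear_simps [simp]:
  "act A (x + y) = act A x + act A y" "act A (r *\<^sub>R x) = r *\<^sub>R act A x"
  by (simp_all add: act_def matrix_add_ldistrib matrix_add_rdistrib_quat matrix_scaleR_mult)

lemma linear_act: "linear (act A)"
  by (rule linearI) simp_all

lemma act_diff [simp]: "act A (x - y) = act A x - act A y"
  by (simp add: linear_act linear_diff)

lemma mink_act [simp]:
  assumes "A \<in> Sp11" shows "mink (act A x) (act A y) = mink x y"
proof -
  have *: "herm (act A x) ** Kmat ** herm (act A y) = A ** (herm x ** Kmat ** herm y) ** madj A" for x y
  proof -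
    have "herm (act A x) ** Kmat ** herm (act A y) =
        A ** herm x ** (madj A ** Kmat ** A) ** herm y ** madj A"
      using assms by (simp only: herm_act matrix_mul_assoc)
    also have "madj A ** Kmat ** A = Kmat"
      using assms by (simp add: Sp11_def)
    finally show ?thesis by (simp only: matrix_mul_assoc)
  qed
  have "(2 * mink (act A x) (act A y)) *\<^sub>R Kmat =
      A ** (herm x ** Kmat ** herm y + herm y ** Kmat ** herm x) ** madj A"
    by (simp only: herm_Kmat_herm[symmetric] * matrix_add_ldistrib matrix_add_rdistrib_quat)
  also have "\<dots> = (2 * mink x y) *\<^sub>R Kmat"
    using assms by (simp only: herm_Kmat_herm matrix_scaleR_mult) (simp add: Sp11_def)
  finally show ?thesis
    by (simp add: Kmat_def mat2_arith quat_eq_iff)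
qed

section \<open>Continuity of the action\<close>

lemma continuous_on_matrix_mult_quat [continuous_intros]:
  fixes f g :: "'a::topological_space \<Rightarrow> quat^2^2"
  assumes "continuous_on S f" "continuous_on S g"
  shows "continuous_on S (\<lambda>x. f x ** g x)"
  unfolding matrix_matrix_mult_def using assms
  by (intro continuous_on_vec_lambda continuous_intros)

lemma continuous_on_mat2 [continuous_intros]:
  assumes "continuous_on S a" "continuous_on S b" "continuous_on S c" "continuous_on S d"
  shows "continuous_on S (\<lambda>x. mat2 (a x) (b x) (c x) (d x))"
  unfolding mat2_def
proof (intro continuous_on_vec_lambda)
  fix i j :: 2
  show "continuous_on S (\<lambda>x. if i = 1 then if j = 1 then a x else b x else if j = 1 then c x else d x)"
    by (cases "i = 1"; cases "j = 1"; simp add: assms)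
qed

lemma continuous_on_vec5 [continuous_intros]:
  assumes "continuous_on S a" "continuous_on S b" "continuous_on S c" "continuous_on S d" "continuous_on S e"
  shows "continuous_on S (\<lambda>x. vec5 (a x) (b x) (c x) (d x) (e x))"
  unfolding vec5_def
proof (intro continuous_on_vec_lambda)
  fix i :: 5
  show "continuous_on S (\<lambda>x. if i = 0 then a x else if i = 1 then b x else if i = 2 then c x
      else if i = 3 then d x else e x)"
    by (cases "i = 0"; cases "i = 1"; cases "i = 2"; cases "i = 3"; simp add: assms)
qed

lemma continuous_on_wq [continuous_intros]:
  "continuous_on S f \<Longrightarrow> continuous_on S (\<lambda>x. wq (f x))"
  unfolding wq_def by (intro continuous_intros)

lemma continuous_on_madj [continuous_intros]:
  "continuous_on S f \<Longrightarrow> continuous_on S (\<lambda>x. madj (f x))"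
  unfolding madj_def by (intro continuous_on_vec_lambda continuous_intros)

lemma continuous_on_act [continuous_intros]:
  assumes "continuous_on S f" "continuous_on S g"
  shows "continuous_on S (\<lambda>x. act (f x) (g x))"
  unfolding act_def unherm_def herm_def
  by (intro continuous_intros assms)

section \<open>Polar decomposition\<close>

lemma wq_unherm [simp]: "wq (unherm S) = S$1$2" and unherm_0 [simp]: "unherm S $ 0 = qRe (S$1$1)"
  by (simp_all add: unherm_def quat_eq_iff)

lemma vec5_eq_wq_iff: "x = y \<longleftrightarrow> x$0 = y$0 \<and> wq x = wq y"
  by (auto simp: vec5_eq_iff quat_eq_iff)

lemma mink_wq: "mink x y = x$0 * y$0 - inner (wq x) (wq y)"
  by (simp add: mink_def inner_quat_def)

lemma mink_commute: "mink x y = mink y x"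
  by (simp add: mink_def)

lemma wq_axis [simp]:
  "wq (axis 0 1) = 0" "wq (axis 1 1) = qk" "wq (axis 2 1) = - qj" "wq (axis 3 1) = qi" "wq (axis 4 1) = 1"
  by (simp_all add: quat_eq_iff axis_def)

lemma mink_axis:
  "mink (axis 0 1) (axis 0 1) = 1"
  "i \<noteq> 0 \<Longrightarrow> mink (axis i 1) (axis i 1) = - 1"
  "i \<noteq> j \<Longrightarrow> mink (axis i 1) (axis j 1) = 0"
  using exhaust_5[of i] exhaust_5[of j] by (auto simp: mink_def axis_def)

lemma diag_in_Sp11 [simp]: "norm p = 1 \<Longrightarrow> norm q = 1 \<Longrightarrow> mat2 p 0 0 q \<in> Sp11"
  by (simp add: mat2_in_Sp11)

lemma act_diag:
  assumes "norm p = 1" "norm q = 1"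
  shows "act (mat2 p 0 0 q) x $ 0 = x$0" "wq (act (mat2 p 0 0 q) x) = p * wq x * qcnj q"
proof -
  have "p * of_real t * qcnj p = of_real t" for t
    using assms(1) by (simp add: of_real_def)
  then show "act (mat2 p 0 0 q) x $ 0 = x$0" "wq (act (mat2 p 0 0 q) x) = p * wq x * qcnj q"
    by (simp_all add: act_def herm_def mat2_arith)
qed

text \<open>A square root of the Hermitian matrix X of the hyperboloid point with spatial part w and
  time coordinate t = sqrt (1 + |w|^2). From X^2 = 2 t X - 1 one gets (1 + X)^2 = 2 (1 + t) X,
  whence the normalising factor. Being Hermitian, it takes the base point, whose matrix is 1, to
  X.\<close>

definition polar :: "quat \<Rightarrow> quat^2^2" where
  "polar w = (1 / sqrt (2 * (1 + sqrt (1 + (norm w)\<^sup>2)))) *\<^sub>R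
     mat2 (of_real (1 + sqrt (1 + (norm w)\<^sup>2))) w (qcnj w) (of_real (1 + sqrt (1 + (norm w)\<^sup>2)))"

lemma polar:
  shows polar_in_Sp11 [simp]: "polar w \<in> Sp11"
    and herm_polar: "herm (act (polar w) (axis 0 1)) =
      mat2 (of_real (sqrt (1 + (norm w)\<^sup>2))) w (qcnj w) (of_real (sqrt (1 + (norm w)\<^sup>2)))"
proof -
  define t where "t = sqrt (1 + (norm w)\<^sup>2)"
  define s where "s = 1 / sqrt (2 * (1 + t))"
  have t: "t > 0" "t\<^sup>2 = 1 + (norm w)\<^sup>2"
    by (simp_all add: t_def add_pos_nonneg)
  have s: "s * s = 1 / (2 * (1 + t))"
    using t by (simp add: s_def)
  have P: "polar w = mat2 (of_real (s * (1 + t))) (s *\<^sub>R w) (s *\<^sub>R qcnj w) (of_real (s * (1 + t)))"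
    by (simp add: polar_def t_def s_def mat2_arith of_real_def)
  have e1: "s * (1 + t) * (s * (1 + t)) - s * (s * (norm w)\<^sup>2) = 1"
  proof -
    have "s * (1 + t) * (s * (1 + t)) - s * (s * (norm w)\<^sup>2) = s * s * ((1 + t)\<^sup>2 - (norm w)\<^sup>2)"
      by (simp add: power2_eq_square algebra_simps)
    also have "(1 + t)\<^sup>2 - (norm w)\<^sup>2 = 2 * (1 + t)"
      using t by (simp add: power2_eq_square algebra_simps)
    finally show ?thesis using t s by simp
  qed
  have e2: "s * (1 + t) * (s * (1 + t)) + s * (s * (norm w)\<^sup>2) = t"
  proof -
    have "s * (1 + t) * (s * (1 + t)) + s * (s * (norm w)\<^sup>2) = s * s * ((1 + t)\<^sup>2 + (norm w)\<^sup>2)"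
      by (simp add: power2_eq_square algebra_simps)
    also have "(1 + t)\<^sup>2 + (norm w)\<^sup>2 = 2 * (1 + t) * t"
      using t by (simp add: power2_eq_square algebra_simps)
    finally show ?thesis using t s by simp
  qed
  have e3: "2 * (s * (s * (1 + t))) = 1"
  proof -
    have "2 * (s * (s * (1 + t))) = s * s * (2 * (1 + t))"
      by (simp add: algebra_simps)
    then show ?thesis using t s by simp
  qed
  have c: "of_real r * q = r *\<^sub>R q" "q * of_real r = r *\<^sub>R q" for r and q :: quat
    by (simp_all add: of_real_def)
  have w2: "qcnj w * w = ((norm w)\<^sup>2) *\<^sub>R 1" "w * qcnj w = ((norm w)\<^sup>2) *\<^sub>R 1"
    by (simp_all only: mult_qcnj) (simp_all add: of_real_def)
  have e1': "s * (s * (norm w)\<^sup>2) - s * (1 + t) * (s * (1 + t)) = - 1"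
    using e1 by linarith
  have e2': "s * (s * (norm w)\<^sup>2) + s * (1 + t) * (s * (1 + t)) = t"
    using e2 by linarith
  note E = e1[unfolded mult.assoc] e1'[unfolded mult.assoc]
  show "polar w \<in> Sp11"
    unfolding P mat2_in_Sp11
    by (simp add: c w2 scaleR_left_diff_distrib[symmetric] of_real_def mult.assoc E)
  then show "herm (act (polar w) (axis 0 1)) = mat2 (of_real (sqrt (1 + (norm w)\<^sup>2))) w (qcnj w)
      (of_real (sqrt (1 + (norm w)\<^sup>2)))"
    unfolding P t_def[symmetric]
    by (simp add: herm_act herm_axis mat2_arith c w2 scaleR_left_distrib[symmetric] of_real_def mult.assoc
        e2[unfolded mult.assoc] e2'[unfolded mult.assoc] e3)
qed

lemma hyp_iff: "x \<in> hyp \<longleftrightarrow> x$0 = sqrt (1 + (norm (wq x))\<^sup>2)"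
proof -
  have "mink x x = (x$0)\<^sup>2 - (norm (wq x))\<^sup>2"
    by (simp add: mink_wq power2_eq_square dot_square_norm)
  moreover have "0 < sqrt (1 + (norm (wq x))\<^sup>2)"
    by (simp add: add_pos_nonneg)
  ultimately show ?thesis
    unfolding hyp_def by (auto intro: real_sqrt_unique[symmetric] simp: add_pos_nonneg)
qed

lemma wq_act_polar [simp]: "wq (act (polar w) (axis 0 1)) = w"
proof -
  have "wq (unherm (herm (act (polar w) (axis 0 1)))) = w"
    unfolding herm_polar wq_unherm by simp
  then show ?thesis by simp
qed

lemma act_polar_wq [simp]:
  assumes "x \<in> hyp" shows "act (polar (wq x)) (axis 0 1) = x"
proof -
  have "herm (act (polar (wq x)) (axis 0 1)) = herm x"
    using assms unfolding herm_polar hyp_iff by (simp add: herm_def)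
  then show ?thesis by simp
qed

text \<open>Only the sign of the time coordinate needs an argument. For an image of the base point
  it is |a|^2 + |b|^2, and \<open>polar\<close> writes any point of the hyperboloid as such an
  image.\<close>

lemma act_in_hyp [simp]:
  assumes "A \<in> Sp11" "x \<in> hyp" shows "act A x \<in> hyp"
proof -
  have *: "act B (axis 0 1) \<in> hyp" if "B \<in> Sp11" for B
  proof -
    obtain a b c d where B: "B = mat2 a b c d" by (cases B rule: mat2_cases)
    have "(norm a)\<^sup>2 = 1 + (norm b)\<^sup>2"
      using that by (simp add: B mat2_in_Sp11 norm_quat_sq quat_eq_iff)
    moreover have "act B (axis 0 1) $ 0 = (norm a)\<^sup>2 + (norm b)\<^sup>2"
      by (simp add: act_def herm_axis B mat2_arith norm_quat_sq)
    ultimately have "act B (axis 0 1) $ 0 > 0"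
      using zero_le_power2[of "norm b"] by linarith
    moreover have "mink (act B (axis 0 1)) (act B (axis 0 1)) = 1"
      using that by (simp add: mink_axis)
    ultimately show ?thesis by (simp add: hyp_def)
  qed
  have "act A x = act (A ** polar (wq x)) (axis 0 1)"
    using assms by simp
  then show ?thesis using *[of "A ** polar (wq x)"] assms by simp
qed

lemma axis0_in_hyp [simp]: "axis 0 1 \<in> hyp"
  by (simp add: hyp_def mink_axis)

text \<open>Fixing the base point means \<open>A ** madj A = mat 1\<close>. Together with
  \<open>A ** Kmat ** madj A = Kmat\<close> this gives both the sum and the difference of the
  squared norms in each row, so the off-diagonal entries vanish.\<close>

lemma stabilizer_diag:
  assumes "A \<in> Sp11" "act A (axis 0 1) = axis 0 1"
  obtains p q where "norm p = 1" "norm q = 1" "A = mat2 p 0 0 q"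
proof -
  obtain a b c d where A: "A = mat2 a b c d" by (cases A rule: mat2_cases)
  have "A ** herm (axis 0 1) ** madj A = herm (axis 0 1)"
    using assms herm_act[of A "axis 0 1"] by simp
  then have "a * qcnj a + b * qcnj b = 1" "c * qcnj c + d * qcnj d = 1"
    by (simp_all add: A mat2_arith herm_axis)
  moreover have "a * qcnj a - b * qcnj b = 1" "c * qcnj c - d * qcnj d = - 1"
    using assms by (simp_all add: A mat2_in_Sp11)
  ultimately have "(norm a)\<^sup>2 + (norm b)\<^sup>2 = 1" "(norm c)\<^sup>2 + (norm d)\<^sup>2 = 1"
      "(norm a)\<^sup>2 - (norm b)\<^sup>2 = 1" "(norm c)\<^sup>2 - (norm d)\<^sup>2 = - 1"
    by (simp_all add: norm_quat_sq quat_eq_iff)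
  then have "(norm a)\<^sup>2 = 1" "(norm b)\<^sup>2 = 0" "(norm c)\<^sup>2 = 0" "(norm d)\<^sup>2 = 1"
    by linarith+
  then have "norm a = 1" "b = 0" "c = 0" "norm d = 1"
    by (simp_all add: power2_eq_1_iff) (metis norm_ge_zero not_one_le_zero neg_0_le_iff_le)+
  then show ?thesis using that A by blast
qed

lemma polar_decomposition:
  assumes "A \<in> Sp11"
  obtains w p q where "norm p = 1" "norm q = 1" "A = polar w ** mat2 p 0 0 q"
proof -
  define w where "w = wq (act A (axis 0 1))"
  have "act (ginv (polar w) ** A) (axis 0 1) = act (ginv (polar w)) (act (polar w) (axis 0 1))"
    using assms by (simp add: w_def del: act_ginv)
  then have "act (ginv (polar w) ** A) (axis 0 1) = axis 0 1" by simp
  then obtain p q where "norm p = 1" "norm q = 1" "ginv (polar w) ** A = mat2 p 0 0 q"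
    using assms by (metis stabilizer_diag Sp11_mult Sp11_ginv polar_in_Sp11)
  moreover have "A = polar w ** (ginv (polar w) ** A)" by simp
  ultimately show ?thesis using that by metis
qed

lemma act_polar_diag [simp]:
  assumes "norm p = 1" "norm q = 1"
  shows "act (polar w ** mat2 p 0 0 q) (axis 0 1) = act (polar w) (axis 0 1)"
proof -
  have "act (mat2 p 0 0 q) (axis 0 1) = axis 0 1"
    using assms by (simp add: vec5_eq_wq_iff act_diag)
  then show ?thesis using assms by simp
qed

lemma continuous_on_ginv [continuous_intros]:
  "continuous_on S f \<Longrightarrow> continuous_on S (\<lambda>x. ginv (f x))"
  unfolding ginv_def by (intro continuous_intros)

lemma continuous_on_polar [continuous_intros]:
  assumes "continuous_on S f" shows "continuous_on S (\<lambda>x. polar (f x))"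
proof -
  have "sqrt (2 * (1 + sqrt (1 + (norm w)\<^sup>2))) \<noteq> 0" for w :: quat
    by (simp add: add_nonneg_eq_0_iff)
  then show ?thesis unfolding polar_def by (intro continuous_intros assms) auto
qed

text \<open>The second entry of the diagonal compact factor. It is singled out because its direction
  will separate the two sheets over a frame.\<close>

definition Qpart :: "quat^2^2 \<Rightarrow> quat" where
  "Qpart A = (ginv (polar (wq (act A (axis 0 1)))) ** A)$2$2"

lemma continuous_on_Qpart [continuous_intros]:
  "continuous_on S f \<Longrightarrow> continuous_on S (\<lambda>x. Qpart (f x))"
  unfolding Qpart_def by (intro continuous_intros)

lemma Qpart_polar_diag [simp]:
  assumes "norm p = 1" "norm q = 1"
  shows "Qpart (polar w ** mat2 p 0 0 q) = q"
  using assms by (simp add: Qpart_def del: act_mult)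

lemma simply_connected_Sp11: "simply_connected Sp11"
proof -
  let ?E = "UNIV \<times> sphere 0 1 \<times> sphere 0 1 :: (quat \<times> quat \<times> quat) set"
  let ?f = "\<lambda>(w, p, q). polar w ** mat2 p 0 0 q"
  let ?g = "\<lambda>A. (wq (act A (axis 0 1)), (ginv (polar (wq (act A (axis 0 1)))) ** A)$1$1, Qpart A)"
  have "homeomorphism ?E Sp11 ?f ?g"
  proof (rule homeomorphismI)
    show "continuous_on ?E ?f" unfolding case_prod_unfold by (intro continuous_intros)
    show "continuous_on Sp11 ?g" by (intro continuous_intros)
    show "?f ` ?E \<subseteq> Sp11" by (auto simp: image_subset_iff)
    show gf: "?g (?f z) = z" if "z \<in> ?E" for z
      using that by (auto simp del: act_mult)
    show "?g ` Sp11 \<subseteq> ?E"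
    proof
      fix z assume "z \<in> ?g ` Sp11"
      then obtain A where A: "A \<in> Sp11" "z = ?g A" by blast
      obtain w p q where "norm p = 1" "norm q = 1" "A = polar w ** mat2 p 0 0 q"
        using polar_decomposition[OF A(1)] .
      then show "z \<in> ?E" using gf[of "(w, p, q)"] A(2) by auto
    qed
    show "?f (?g A) = A" if A: "A \<in> Sp11" for A
    proof -
      obtain w p q where "norm p = 1" "norm q = 1" "A = polar w ** mat2 p 0 0 q"
        using polar_decomposition[OF A] .
      then show ?thesis using gf[of "(w, p, q)"] by auto
    qed
  qed
  moreover have "simply_connected ?E"
    by (intro simply_connected_Times simply_connected_sphere convex_imp_simply_connected) auto
  ultimately show ?thesis
    using homeomorphic_simply_connected homeomorphic_def by blast
qed

section \<open>The frame bundle and its double cover\<close>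

lemma all_less_4: "(\<forall>i<4::nat. P i) \<longleftrightarrow> P 0 \<and> P 1 \<and> P 2 \<and> P 3"
  by (auto simp: numeral_eq_Suc less_Suc_eq)

lemma is_frame_iff:
  "is_frame (x, f1, f2, f3, f4) \<longleftrightarrow> x \<in> hyp \<and>
     mink f1 x = 0 \<and> mink f2 x = 0 \<and> mink f3 x = 0 \<and> mink f4 x = 0 \<and>
     mink f1 f1 = - 1 \<and> mink f2 f2 = - 1 \<and> mink f3 f3 = - 1 \<and> mink f4 f4 = - 1 \<and>
     mink f1 f2 = 0 \<and> mink f1 f3 = 0 \<and> mink f1 f4 = 0 \<and>
     mink f2 f3 = 0 \<and> mink f2 f4 = 0 \<and> mink f3 f4 = 0 \<and>
     det (frame_mat (x, f1, f2, f3, f4)) > 0"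
  unfolding is_frame_def all_less_4 by (auto simp: mink_commute)

lemma axis_0: "axis 0 1 $ (0::5) = (1::real)" "axis 1 1 $ (0::5) = (0::real)"
  "axis 2 1 $ (0::5) = (0::real)" "axis 3 1 $ (0::5) = (0::real)" "axis 4 1 $ (0::5) = (0::real)"
  by (simp_all add: axis_def)

lemma wq_scaleR: "wq (r *\<^sub>R x) = r *\<^sub>R wq x" and wq_add: "wq (x + y) = wq x + wq y"
  by (simp_all add: quat_eq_iff)

section \<open>Frames obtained from group elements\<close>

definition spin_frame :: "quat^2^2 \<Rightarrow> frame" where
  "spin_frame A =
    (act A (axis 0 1), act A (axis 1 1), act A (axis 2 1), act A (axis 3 1), act A (axis 4 1))"

lemma spin_frame_one [simp]: "spin_frame (mat 1) = base_frame"
  by (simp add: spin_frame_def base_frame_def)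

lemma frame_mat_sel [simp]:
  "frame_mat (x, f1, f2, f3, f4) $ 0 = x" "frame_mat (x, f1, f2, f3, f4) $ 1 = f1"
  "frame_mat (x, f1, f2, f3, f4) $ 2 = f2" "frame_mat (x, f1, f2, f3, f4) $ 3 = f3"
  "frame_mat (x, f1, f2, f3, f4) $ 4 = f4"
  by (simp_all add: frame_mat_def)

text \<open>With J the diagonal signature matrix, orthonormality reads M J M^T = J, so N = J M^T J
  is a right inverse of M.\<close>

lemma det_frame_mat_nonzero:
  assumes "mink x x = 1" "mink f1 x = 0" "mink f2 x = 0" "mink f3 x = 0" "mink f4 x = 0"
    "mink f1 f1 = - 1" "mink f2 f2 = - 1" "mink f3 f3 = - 1" "mink f4 f4 = - 1"
    "mink f1 f2 = 0" "mink f1 f3 = 0" "mink f1 f4 = 0" "mink f2 f3 = 0" "mink f2 f4 = 0" "mink f3 f4 = 0"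
  shows "det (frame_mat (x, f1, f2, f3, f4)) \<noteq> 0"
proof -
  define M where "M = frame_mat (x, f1, f2, f3, f4)"
  define s where "s i = (if i = 0 then 1 else - 1 :: real)" for i :: 5
  define N :: "real^5^5" where "N = (\<chi> i j. s i * s j * M$j$i)"
  have "(M ** N)$i$j = s j * mink (M$i) (M$j)" for i j
    by (simp add: N_def matrix_matrix_mult_def sum_5 mink_def s_def algebra_simps)
  moreover have "\<forall>i j. s j * mink (M$i) (M$j) = (if i = j then 1 else 0)"
    unfolding forall_5 using assms by (simp add: M_def s_def mink_commute)
  ultimately have "M ** N = mat 1"
    by (simp add: vec_eq_iff mat_def)
  then have "det M * det N = 1"
    by (metis det_I det_mul)
  then show ?thesis by (auto simp: M_def)
qed

lemma continuous_on_spin_frame [continuous_intros]: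
  "continuous_on S f \<Longrightarrow> continuous_on S (\<lambda>x. spin_frame (f x))"
  unfolding spin_frame_def by (intro continuous_intros)

text \<open>Positive orientation is obtained topologically: the determinant is continuous and never
  0 on the connected group, and it equals 1 at the identity.\<close>

lemma spin_frame_in_frames [simp]:
  assumes "A \<in> Sp11" shows "spin_frame A \<in> frames"
proof -
  let ?d = "\<lambda>A. det (frame_mat (spin_frame A))"
  have "continuous_on Sp11 (\<lambda>A. frame_mat (spin_frame A) $ i $ j)" for i j
    using exhaust_5[of i] by (elim disjE; hypsubst; simp add: spin_frame_def; intro continuous_intros)
  then have "continuous_on Sp11 ?d"
    unfolding det_def by (intro continuous_on_sum continuous_on_mult continuous_on_const continuous_on_prod)
  moreover have "connected Sp11"
    using simply_connected_Sp11 simply_connected_imp_connected by blast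
  ultimately have conn: "connected (?d ` Sp11)"
    by (rule connected_continuous_image)
  have nz: "?d B \<noteq> 0" if "B \<in> Sp11" for B
    using that unfolding spin_frame_def by (intro det_frame_mat_nonzero) (simp_all add: mink_axis)
  have "frame_mat base_frame = mat 1"
    unfolding vec_eq_iff forall_5 by (simp add: base_frame_def axis_def mat_def)
  then have one: "1 \<in> ?d ` Sp11"
    by (intro image_eqI[of _ _ "mat 1"]) simp_all
  have "?d A > 0"
  proof (rule ccontr)
    assume "\<not> ?d A > 0"
    then have "0 \<in> ?d ` Sp11"
      using connectedD_interval[OF conn, of "?d A" 1 0] assms one by auto
    then show False using nz by auto
  qed
  then show ?thesis
    using assms unfolding frames_def spin_frame_def mem_Collect_eq is_frame_iff by (simp add: mink_axis)
qed

text \<open>Since z and i both square to -1, p = 1 - z i satisfies p i = i + z = z p. It vanishes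
  only for z = -i, where j does the job.\<close>

lemma rotate_qi_to:
  assumes "norm z = 1" "qRe z = 0"
  obtains p where "norm p = 1" "p * qi = z * p"
proof -
  have z: "qI z * qI z + qJ z * qJ z + qK z * qK z = 1"
    using norm_quat_sq[of z] assms by simp
  then have zz: "z * z = - 1"
    using assms by (simp add: quat_eq_iff)
  show ?thesis
  proof (cases "1 - z * qi = 0")
    case True
    then have "z = - qi" by (simp add: quat_eq_iff)
    then show ?thesis using that[of qj] by (simp add: quat_eq_iff norm_quat_def inner_quat_def)
  next
    case False
    have "qi * qi = - 1" by (simp add: quat_eq_iff)
    then have "(1 - z * qi) * qi = z * (1 - z * qi)"
      by (simp add: left_diff_distrib right_diff_distrib mult.assoc[symmetric] zz) (simp add: mult.assoc)
    then show ?thesis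
      using that[of "sgn (1 - z * qi)"] False by (simp add: norm_sgn sgn_div_norm)
  qed
qed

text \<open>The same device with 1 + z j, which vanishes only for z = j. As z lies in the span of j
  and k, the product z j lies in the span of 1 and i; so p commutes with i and an earlier alignment
  of i is not disturbed.\<close>

lemma rotate_qj_to:
  assumes "norm z = 1" "qRe z = 0" "qI z = 0"
  obtains p where "norm p = 1" "p * qi = qi * p" "p * - qj = z * p"
proof -
  have z: "qJ z * qJ z + qK z * qK z = 1"
    using norm_quat_sq[of z] assms by simp
  then have zz: "z * z = - 1"
    using assms by (simp add: quat_eq_iff)
  show ?thesis
  proof (cases "1 + z * qj = 0")
    case True
    then have "z = qj" by (simp add: quat_eq_iff)
    then show ?thesis using that[of qi] by (simp add: quat_eq_iff norm_quat_def inner_quat_def)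
  next
    case False
    have "qj * qj = - 1" by (simp add: quat_eq_iff)
    then have "(1 + z * qj) * - qj = z * (1 + z * qj)"
      by (simp add: distrib_left distrib_right mult.assoc[symmetric] zz) (simp add: mult.assoc)
    moreover have "(1 + z * qj) * qi = qi * (1 + z * qj)"
      using assms by (simp add: quat_eq_iff)
    ultimately have "sgn (1 + z * qj) * - qj = z * sgn (1 + z * qj)" "sgn (1 + z * qj) * qi = qi * sgn (1 + z * qj)"
      by (simp_all only: sgn_div_norm mult_scaleR_left mult_scaleR_right)
    then show ?thesis
      using that[of "sgn (1 + z * qj)"] False by (simp add: norm_sgn)
  qed
qed

lemma inner_mult_unit:
  fixes x y p :: quat assumes "norm p = 1"
  shows "inner (x * p) (y * p) = inner x y" "inner (p * x) (p * y) = inner x y"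
proof -
  have "inner (x * p) (y * p) = inner x y * (norm p)\<^sup>2" "inner (p * x) (p * y) = inner x y * (norm p)\<^sup>2"
    by (simp_all add: norm_quat_sq inner_quat_def algebra_simps)
  then show "inner (x * p) (y * p) = inner x y" "inner (p * x) (p * y) = inner x y"
    using assms by simp_all
qed

text \<open>Right multiplication by \<open>qcnj y4\<close> sends the last vector to 1. One
  conjugation then sends the third to i, and a conjugation fixing i sends the second to -j. What
  remains of the first is a unit vector orthogonal to 1, i and j, hence k or -k; the sign s records
  the orientation.\<close>

lemma orthonormal_quat:
  fixes y1 y2 y3 y4 :: quat
  assumes "norm y1 = 1" "norm y2 = 1" "norm y3 = 1" "norm y4 = 1"
    "inner y1 y2 = 0" "inner y1 y3 = 0" "inner y1 y4 = 0" "inner y2 y3 = 0" "inner y2 y4 = 0" "inner y3 y4 = 0"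
  obtains p q s where "norm p = 1" "norm q = 1" "s = 1 \<or> s = - 1"
    "y1 = s *\<^sub>R (p * qk * qcnj q)" "y2 = p * - qj * qcnj q" "y3 = p * qi * qcnj q" "y4 = p * qcnj q"
proof -
  define z where "z y = y * qcnj y4" for y
  have inz: "inner (z x) (z y) = inner x y" for x y
    using assms by (simp add: z_def inner_mult_unit)
  have nz: "norm (z y) = norm y" for y
    using assms by (simp add: z_def norm_mult)
  have rz: "qRe (z y) = inner y y4" for y
    by (simp add: z_def inner_quat_def)
  obtain p1 where p1: "norm p1 = 1" "p1 * qi = z y3 * p1"
    using rotate_qi_to[of "z y3"] assms nz rz by auto
  define c where "c y = qcnj p1 * z y * p1" for y
  have inc: "inner (c x) (c y) = inner x y" for x y
    using p1 inz by (simp add: c_def inner_mult_unit)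
  have nc: "norm (c y) = norm y" for y
    using p1 nz by (simp add: c_def norm_mult)
  have rc: "qRe (c y) = inner y y4" for y
  proof -
    have "qRe (c y) = qRe (z y) * (norm p1)\<^sup>2"
      by (simp add: c_def norm_quat_sq algebra_simps)
    then show ?thesis using p1 rz by simp
  qed
  have c3: "c y3 = qi"
    using p1 unfolding c_def mult.assoc p1(2)[symmetric] by (simp add: mult.assoc[symmetric])
  have "qI (c y2) = inner (c y2) (c y3)" by (simp add: c3 inner_quat_def)
  then obtain p2 where p2: "norm p2 = 1" "p2 * qi = qi * p2" "p2 * - qj = c y2 * p2"
    using rotate_qj_to[of "c y2"] inc nc rc assms by (metis inner_commute)
  define d where "d y = qcnj p2 * c y * p2" for y
  have ind: "inner (d x) (d y) = inner x y" for x y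
    using p2 inc by (simp add: d_def inner_mult_unit)
  have nd: "norm (d y) = norm y" for y
    using p2 nc by (simp add: d_def norm_mult)
  have rd: "qRe (d y) = inner y y4" for y
  proof -
    have "qRe (d y) = qRe (c y) * (norm p2)\<^sup>2"
      by (simp add: d_def norm_quat_sq algebra_simps)
    then show ?thesis using p2 rc by simp
  qed
  have d3: "d y3 = qi"
    using p2 unfolding d_def c3 mult.assoc p2(2)[symmetric] by (simp add: mult.assoc[symmetric])
  have d2: "d y2 = - qj"
    using p2 unfolding d_def mult.assoc p2(3)[symmetric] by (simp add: mult.assoc[symmetric])
  have "qRe (d y1) = 0" using rd assms by simp
  moreover have "inner (d y1) (d y3) = 0" "inner (d y1) (d y2) = 0"
    using ind assms by simp_all
  then have "qI (d y1) = 0" "qJ (d y1) = 0"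
    by (simp_all add: d2 d3 inner_quat_def)
  moreover have "norm (d y1) = 1" using nd assms by simp
  ultimately have "(qK (d y1))\<^sup>2 = 1"
    using norm_quat_sq[of "d y1"] by (simp add: power2_eq_square)
  then have s: "qK (d y1) = 1 \<or> qK (d y1) = - 1"
    by (simp add: power2_eq_1_iff)
  have d1: "d y1 = qK (d y1) *\<^sub>R qk"
    using \<open>qRe (d y1) = 0\<close> \<open>qI (d y1) = 0\<close> \<open>qJ (d y1) = 0\<close> by (simp add: quat_eq_iff)
  define p where "p = p1 * p2"
  define q where "q = qcnj y4 * p"
  have n: "norm p = 1" "norm q = 1"
    using p1 p2 assms by (simp_all add: p_def q_def norm_mult)
  have rec: "y = p * d y * qcnj q" for y
  proof -
    have "p * d y * qcnj q = (p1 * ((p2 * qcnj p2) * (qcnj p1 * z y * p1) * (p2 * qcnj p2)) * qcnj p1) * y4"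
      by (simp add: p_def q_def d_def c_def mult.assoc)
    also have "\<dots> = (p1 * qcnj p1) * z y * (p1 * qcnj p1) * y4"
      using p2 by (simp add: mult.assoc)
    also have "\<dots> = y * (qcnj y4 * y4)"
      using p1 by (simp add: z_def mult.assoc)
    finally show ?thesis using assms by simp
  qed
  have "d y4 = 1"
    using p1 p2 assms by (simp add: d_def c_def z_def)
  then have "y4 = p * qcnj q" using rec[of y4] by simp
  moreover have "y1 = qK (d y1) *\<^sub>R (p * qk * qcnj q)"
    by (subst rec[of y1], subst d1) simp
  moreover have "y2 = p * - qj * qcnj q" "y3 = p * qi * qcnj q"
    using rec[of y2] rec[of y3] d2 d3 by simp_all
  ultimately show ?thesis using that[OF n s] by blast
qed

lemma spin_frame_surj:
  assumes "F \<in> frames"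
  obtains A where "A \<in> Sp11" "spin_frame A = F"
proof -
  obtain x f1 f2 f3 f4 where F: "F = (x, f1, f2, f3, f4)" by (cases F) auto
  have fr: "is_frame (x, f1, f2, f3, f4)" using assms by (simp add: F frames_def)
  define P where "P = polar (wq x)"
  have P: "P \<in> Sp11" by (simp add: P_def)
  have x: "x \<in> hyp" using fr by (simp add: is_frame_iff)
  then have Px: "act P (axis 0 1) = x" by (simp add: P_def)
  define g where "g v = act (ginv P) v" for v
  have gx: "g x = axis 0 1" using P Px[symmetric] by (simp add: g_def)
  have mg: "mink (g u) (g v) = mink u v" for u v using P by (simp add: g_def)
  have Pg: "act P (g v) = v" for v using P by (simp add: g_def)
  have g0: "g v $ 0 = mink v x" for v
    using mg[of v x] by (simp add: gx) (simp add: mink_def axis_def)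
  have ing: "inner (wq (g u)) (wq (g v)) = mink u x * mink v x - mink u v" for u v
    using mg[of u v] g0 by (simp add: mink_wq)
  have ng: "norm (wq (g u)) = 1" if "mink u x = 0" "mink u u = - 1" for u
    using ing[of u u] that by (simp add: norm_eq_sqrt_inner)
  obtain p q s where pq: "norm p = 1" "norm q = 1" "s = 1 \<or> s = - 1"
    "wq (g f1) = s *\<^sub>R (p * qk * qcnj q)" "wq (g f2) = p * - qj * qcnj q"
    "wq (g f3) = p * qi * qcnj q" "wq (g f4) = p * qcnj q"
    by (rule orthonormal_quat[of "wq (g f1)" "wq (g f2)" "wq (g f3)" "wq (g f4)"])
      (use fr in \<open>simp_all add: ing ng is_frame_iff\<close>)
  define D where "D = mat2 p 0 0 q"
  have D: "D \<in> Sp11" using pq by (simp add: D_def)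
  have ss: "s * s = 1" using pq(3) by auto
  have dg: "act D (axis 0 1) = axis 0 1" "act D (axis 1 1) = s *\<^sub>R g f1" "act D (axis 2 1) = g f2"
     "act D (axis 3 1) = g f3" "act D (axis 4 1) = g f4"
    using fr[unfolded is_frame_iff] pq act_diag[OF pq(1,2)] axis_0
    by (simp_all only: vec5_eq_wq_iff D_def wq_axis wq_scaleR vector_scaleR_component g0) (simp_all add: ss)
  have eq: "spin_frame (P ** D) = (x, s *\<^sub>R f1, f2, f3, f4)"
    using P D Px dg Pg by (simp add: spin_frame_def)
  \<comment> \<open>Both \<open>spin_frame (P ** D)\<close> and the given frame are positive, but s
    = -1 would negate one row of the determinant.\<close>
  have "s = 1"
  proof (rule ccontr)
    assume "s \<noteq> 1"
    then have s: "s = - 1" using pq by simp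
    have "frame_mat (x, s *\<^sub>R f1, f2, f3, f4) = (\<chi> i. if i = 1 then s *s f1 else frame_mat (x, f1, f2, f3, f4) $ i)"
      by (rule vec5_eq_iff[THEN iffD2]) (simp add: scalar_mult_eq_scaleR)
    moreover have "frame_mat (x, f1, f2, f3, f4) = (\<chi> i. if i = 1 then f1 else frame_mat (x, f1, f2, f3, f4) $ i)"
      by (rule vec5_eq_iff[THEN iffD2]) simp
    ultimately have "det (frame_mat (x, s *\<^sub>R f1, f2, f3, f4)) = s * det (frame_mat (x, f1, f2, f3, f4))"
      using det_row_mul[of "1::5" s "\<lambda>_. f1" "\<lambda>i. frame_mat (x, f1, f2, f3, f4) $ i"] by simp
    moreover have "det (frame_mat (x, s *\<^sub>R f1, f2, f3, f4)) > 0"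
      using spin_frame_in_frames[of "P ** D"] P D eq unfolding frames_def is_frame_iff by (simp add: is_frame_iff)
    ultimately show False using fr s by (simp add: is_frame_iff)
  qed
  then show ?thesis using that[of "P ** D"] P D eq F by simp
qed

text \<open>It gives the \<open>THE\<close> in \<open>v1_out\<close> its value. The group element D
  relating the two frames fixes the axes 0 and 4, so it is diagonal with p = q. Fixing the axes 2
  and 3 makes p commute with j and i, hence with k, so axis 1 is fixed too.\<close>

lemma is_frame_unique:
  assumes "is_frame (x, v, a, b, n)" "is_frame (x, v', a, b, n)"
  shows "v = v'"
proof -
  obtain A where A: "A \<in> Sp11" "spin_frame A = (x, v, a, b, n)"
    using spin_frame_surj assms(1) unfolding frames_def by blast
  obtain B where B: "B \<in> Sp11" "spin_frame B = (x, v', a, b, n)"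
    using spin_frame_surj assms(2) unfolding frames_def by blast
  define D where "D = ginv A ** B"
  have D: "D \<in> Sp11" using A B by (simp add: D_def)
  have DB: "act D y = act (ginv A) (act B y)" for y using A B by (simp add: D_def)
  have fix0: "act D (axis i 1) = axis i 1" if "act A (axis i 1) = act B (axis i 1)" for i
    unfolding DB that[symmetric] using A by simp
  have "act D (axis 0 1) = axis 0 1" and fx: "act D (axis 2 1) = axis 2 1"
    "act D (axis 3 1) = axis 3 1" "act D (axis 4 1) = axis 4 1"
    using A B by (auto intro!: fix0 simp: spin_frame_def)
  then obtain p q where pq: "norm p = 1" "norm q = 1" "D = mat2 p 0 0 q"
    using stabilizer_diag[OF D] by blast
  have "p * qcnj q = 1" using fx(3) pq act_diag(2)[OF pq(1,2), of "axis 4 1"] by simp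
  then have "p * qcnj q * q = q" by simp
  then have "p = q" using pq by (simp add: mult.assoc)
  have i: "p * qi * qcnj p = qi" and j: "p * qj * qcnj p = qj"
    using fx act_diag(2)[OF pq(1,2)] pq \<open>p = q\<close> wq_axis by (metis, metis minus_equation_iff mult_minus_left mult_minus_right)
  have ij: "qi * qj = qk" by (simp add: quat_eq_iff)
  have "p * qk * qcnj p = p * qi * (qcnj p * p) * qj * qcnj p"
    using pq unfolding ij[symmetric] by (simp add: mult.assoc)
  also have "\<dots> = (p * qi * qcnj p) * (p * qj * qcnj p)" by (simp add: mult.assoc)
  finally have "p * qk * qcnj p = qk" unfolding i j ij .
  then have "act D (axis 1 1) = axis 1 1"
    using pq \<open>p = q\<close> by (simp add: vec5_eq_wq_iff act_diag)
  moreover have "act A (act D (axis 1 1)) = act B (axis 1 1)"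
    using A by (simp add: DB)
  ultimately show ?thesis using A B by (simp add: spin_frame_def)
qed

text \<open>On the frame of \<open>polar w ** mat2 p 0 0 q\<close> the coordinates of the four vectors are \<open>p u (qcnj q)\<close> for
  \<open>u = k, -j, i, 1\<close>, and \<open>\<Sum> u y (qcnj u) = 4 Re y\<close>, so \<open>frame_part r\<close> recovers \<open>p\<close> up to the real factor
  \<open>4 Re (qcnj q * r)\<close>, whose sign separates the two sheets.\<close>

definition frame_coord :: "real^5 \<Rightarrow> real^5 \<Rightarrow> quat" where
  "frame_coord x f = wq (act (ginv (polar (wq x))) f)"

definition frame_part :: "quat \<Rightarrow> frame \<Rightarrow> quat" where
  "frame_part r = (\<lambda>(x, f1, f2, f3, f4). frame_coord x f1 * r * qcnj qk - frame_coord x f2 * r * qcnj qj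
      + frame_coord x f3 * r * qcnj qi + frame_coord x f4 * r)"

text \<open>A local section: s selects the sheet, and the second entry is recovered from the last
  vector, whose coordinate is p conj(q).\<close>

definition frame_lift :: "real \<Rightarrow> quat \<Rightarrow> frame \<Rightarrow> quat^2^2" where
  "frame_lift s r = (\<lambda>(x, f1, f2, f3, f4). let p = s *\<^sub>R sgn (frame_part r (x, f1, f2, f3, f4)) in
     polar (wq x) ** mat2 p 0 0 (qcnj (frame_coord x f4) * p))"

lemma frame_coord_polar_diag:
  assumes "norm p = 1" "norm q = 1"
  shows "frame_coord (act (polar w ** mat2 p 0 0 q) (axis 0 1)) (act (polar w ** mat2 p 0 0 q) v) = p * wq v * qcnj q"
proof -
  have "act (ginv (polar w)) (act (polar w ** mat2 p 0 0 q) v) = act (mat2 p 0 0 q) v"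
    using assms by simp
  then show ?thesis using assms by (simp add: frame_coord_def act_diag del: act_mult)
qed

lemma frame_part_polar_diag:
  assumes "norm p = 1" "norm q = 1"
  shows "frame_part r (spin_frame (polar w ** mat2 p 0 0 q)) = (4 * qRe (qcnj q * r)) *\<^sub>R p"
proof -
  let ?y = "qcnj q * r"
  have "frame_part r (spin_frame (polar w ** mat2 p 0 0 q)) =
     p * (qk * ?y * qcnj qk + qj * ?y * qcnj qj + qi * ?y * qcnj qi + ?y)"
    using assms by (simp only: spin_frame_def frame_part_def case_prod_conv frame_coord_polar_diag wq_axis)
      (simp add: mult.assoc distrib_left)
  also have "qk * ?y * qcnj qk + qj * ?y * qcnj qj + qi * ?y * qcnj qi + ?y = of_real (4 * qRe ?y)"
    by (simp only: quat_eq_iff quat_mult_sel qcnj_sel quat_add_sel quat_of_real_sel qRe.simps qI.simps qJ.simps qK.simps) simp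
  finally show ?thesis by (simp add: of_real_def)
qed

section \<open>The covering property\<close>

lemma continuous_on_frame_coord [continuous_intros]:
  "continuous_on S f \<Longrightarrow> continuous_on S g \<Longrightarrow> continuous_on S (\<lambda>x. frame_coord (f x) (g x))"
  unfolding frame_coord_def by (intro continuous_intros)

lemma continuous_on_frame_part: "continuous_on S (frame_part r)"
  unfolding frame_part_def case_prod_unfold by (intro continuous_intros)

text \<open>Around F0, take for r the second compact entry of some lift. Then Re (conj(q) r) is 1 at
  that lift, and T is the open set of frames where this real part is nonzero, a condition that
  \<open>frame_part r\<close> detects on frames. The two sheets V 1 and V (-1) over T are told apart
  by the sign of the real part.\<close>

theorem covering_space_spin_frame: "covering_space Sp11 spin_frame frames"
proof
  show "continuous_on Sp11 spin_frame" by (intro continuous_intros)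
  show "spin_frame ` Sp11 = frames"
    using spin_frame_surj spin_frame_in_frames by blast
  fix F0 assume "F0 \<in> frames"
  then obtain A0 where A0: "A0 \<in> Sp11" "spin_frame A0 = F0" using spin_frame_surj by blast
  obtain w0 p0 r where r: "norm p0 = 1" "norm r = 1" "A0 = polar w0 ** mat2 p0 0 0 r"
    using polar_decomposition[OF A0(1)] .
  define T where "T = {F \<in> frames. frame_part r F \<noteq> 0}"
  define V where "V s = {A \<in> Sp11. s * qRe (qcnj (Qpart A) * r) > 0}" for s
  have part: "\<exists>w p q. A = polar w ** mat2 p 0 0 q \<and> norm p = 1 \<and> norm q = 1 \<and> Qpart A = q \<and>
      frame_part r (spin_frame A) = (4 * qRe (qcnj q * r)) *\<^sub>R p" if "A \<in> Sp11" for A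
    using polar_decomposition[OF that] frame_part_polar_diag Qpart_polar_diag by metis
  have "F0 \<in> T"
    using \<open>F0 \<in> frames\<close> A0 r frame_part_polar_diag[of p0 r r w0] by (auto simp: T_def)
  moreover have "openin (top_of_set frames) T"
  proof -
    have "openin (top_of_set frames) (frames \<inter> frame_part r -` (- {0}))"
      by (intro continuous_openin_preimage_gen continuous_on_frame_part) auto
    also have "frames \<inter> frame_part r -` (- {0}) = T" by (auto simp: T_def)
    finally show ?thesis .
  qed
  moreover have "\<Union>{V 1, V (- 1)} = Sp11 \<inter> spin_frame -` T"
  proof -
    have "A \<in> V 1 \<or> A \<in> V (- 1) \<longleftrightarrow> spin_frame A \<in> T" if A: "A \<in> Sp11" for A
      using part[OF A] A by (auto simp: V_def T_def)
    moreover have "V 1 \<union> V (- 1) \<subseteq> Sp11" by (auto simp: V_def)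
    ultimately have "V 1 \<union> V (- 1) = Sp11 \<inter> spin_frame -` T" by blast
    then show ?thesis by simp
  qed
  moreover have "openin (top_of_set Sp11) (V s)" for s
  proof -
    have "openin (top_of_set Sp11) (Sp11 \<inter> (\<lambda>A. s * qRe (qcnj (Qpart A) * r)) -` {0<..})"
      by (intro continuous_openin_preimage_gen continuous_intros)
    also have "Sp11 \<inter> (\<lambda>A. s * qRe (qcnj (Qpart A) * r)) -` {0<..} = V s" by (auto simp: V_def)
    finally show ?thesis .
  qed
  moreover have "pairwise disjnt {V 1, V (- 1)}"
    by (auto simp: pairwise_insert disjnt_iff V_def)
  moreover have "homeomorphism (V s) T spin_frame (frame_lift s r)" if s: "s = 1 \<or> s = - 1" for s
  proof (rule homeomorphismI)
    show "continuous_on (V s) spin_frame" by (intro continuous_intros)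
    have "continuous_on T (frame_part r)" by (rule continuous_on_frame_part)
    moreover have "frame_part r F \<noteq> 0" if "F \<in> T" for F using that by (simp add: T_def)
    ultimately show "continuous_on T (frame_lift s r)"
      unfolding frame_lift_def case_prod_unfold Let_def prod.collapse
      by (intro continuous_intros) auto
    show "spin_frame ` V s \<subseteq> T"
    proof
      fix F assume "F \<in> spin_frame ` V s"
      then obtain A where A: "A \<in> V s" "F = spin_frame A" by blast
      then show "F \<in> T" using part[of A] by (auto simp: V_def T_def simp del: quat_mult_sel)
    qed
    show lift: "frame_lift s r (spin_frame A) = A" if A: "A \<in> V s" for A
    proof -
      obtain w p q where pq: "A = polar w ** mat2 p 0 0 q" "norm p = 1" "norm q = 1" "Qpart A = q"
        "frame_part r (spin_frame A) = (4 * qRe (qcnj q * r)) *\<^sub>R p"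
        using part[of A] A by (auto simp: V_def)
      have "s * sgn (qRe (qcnj q * r)) = 1"
        using A s pq(4) by (auto simp: V_def zero_less_mult_iff)
      moreover have "sgn p = p"
        using pq(2) by (simp add: sgn_div_norm)
      then have "sgn (frame_part r (spin_frame A)) = sgn (qRe (qcnj q * r)) *\<^sub>R p"
        unfolding pq(5) by (simp add: sgn_scaleR sgn_mult del: quat_mult_sel qcnj_sel)
      ultimately have sg: "s *\<^sub>R sgn (frame_part r (spin_frame A)) = p"
        by (simp del: quat_mult_sel qcnj_sel)
      have cd: "frame_coord (act A (axis 0 1)) (act A (axis 4 1)) = p * qcnj q"
        using pq frame_coord_polar_diag[of p q w "axis 4 1"] by simp
      have w: "wq (act A (axis 0 1)) = w" using pq by (simp del: act_mult)
      have "qcnj (p * qcnj q) * p = q" using pq(2) by (simp add: mult.assoc)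
      then show ?thesis
        unfolding frame_lift_def spin_frame_def case_prod_conv Let_def sg[unfolded spin_frame_def] cd w
        by (simp add: pq(1))
    qed
    have ex: "\<exists>A\<in>V s. spin_frame A = F" if F: "F \<in> T" for F
    proof -
      obtain A where A: "A \<in> Sp11" "spin_frame A = F"
        using F spin_frame_surj unfolding T_def by blast
      then obtain w p q where pq: "A = polar w ** mat2 p 0 0 q" "norm p = 1" "norm q = 1" "Qpart A = q"
        "frame_part r F = (4 * qRe (qcnj q * r)) *\<^sub>R p"
        using part[of A] by auto
      have nz: "qRe (qcnj q * r) \<noteq> 0" using F pq by (auto simp: T_def)
      \<comment> \<open>The other preimage, -A. The action is quadratic in A, so the frame is the
        same, while the real part that selects the sheet changes sign.\<close>
      define A' where "A' = polar w ** mat2 (- p) 0 0 (- q)"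
      obtain a b c d where P: "polar w = mat2 a b c d" by (rule mat2_cases)
      have "act A' x = act A x" for x
        by (simp add: act_def A'_def pq(1) P herm_def mat2_arith algebra_simps)
      then have "spin_frame A' = F" using A by (simp add: spin_frame_def)
      moreover have "A' \<in> Sp11" "Qpart A' = - q" using pq by (simp_all add: A'_def)
      moreover have "qRe (qcnj (- q) * r) = - qRe (qcnj q * r)" by simp
      ultimately show ?thesis
        using A pq(4) nz s unfolding V_def mem_Collect_eq
        by (cases "s * qRe (qcnj q * r) > 0") (force simp del: quat_mult_sel)+
    qed
    then show "frame_lift s r ` T \<subseteq> V s"
      using lift by force
    show "spin_frame (frame_lift s r F) = F" if "F \<in> T" for F
      using ex[OF that] lift by force
  qed
  ultimately show "\<exists>T. F0 \<in> T \<and> openin (top_of_set frames) T \<and>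
      (\<exists>v. \<Union>v = Sp11 \<inter> spin_frame -` T \<and> (\<forall>u\<in>v. openin (top_of_set Sp11) u) \<and>
        pairwise disjnt v \<and> (\<forall>u\<in>v. \<exists>q. homeomorphism u T spin_frame q))"
    by (intro exI[of _ T] conjI exI[of _ "{V 1, V (- 1)}"]) blast+
qed

section \<open>Spin frames as elements of the group\<close>

text \<open>The endpoint of the lift starting at the identity serves as a name for the homotopy
  class of \<open>g\<close>. The condition is restricted to the unit interval because the
  definitions leave paths unconstrained outside it.\<close>

definition spin_lift :: "(real \<Rightarrow> frame) \<Rightarrow> quat^2^2 \<Rightarrow> bool" where
  "spin_lift g A \<longleftrightarrow> (\<exists>h. path h \<and> path_image h \<subseteq> Sp11 \<and> pathstart h = mat 1 \<and> pathfinish h = A \<and>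
     (\<forall>t\<in>{0..1}. spin_frame (h t) = g t))"

lemma spin_liftD:
  assumes "spin_lift g A"
  shows "A \<in> Sp11" "path g" "path_image g \<subseteq> frames" "pathstart g = base_frame" "pathfinish g = spin_frame A"
proof -
  obtain h where h: "path h" "path_image h \<subseteq> Sp11" "pathstart h = mat 1" "pathfinish h = A"
    "\<forall>t\<in>{0..1}. spin_frame (h t) = g t"
    using assms unfolding spin_lift_def by blast
  show "A \<in> Sp11" using h by (metis pathfinish_in_path_image subsetD)
  show "path g"
  proof -
    have "path (\<lambda>t. spin_frame (h t))" using h(1) unfolding path_def by (intro continuous_intros)
    then show ?thesis by (rule path_eq) (use h(5) in auto)
  qed
  show "path_image g \<subseteq> frames"
  proof -
    have "g t \<in> frames" if "t \<in> {0..1}" for t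
    proof -
      have "h t \<in> Sp11" using h(2) that by (auto simp: path_image_def)
      then show ?thesis using spin_frame_in_frames h(5) that by metis
    qed
    then show ?thesis by (auto simp: path_image_def)
  qed
  show "pathstart g = base_frame" "pathfinish g = spin_frame A"
    using h(3,4) h(5)[rule_format, of 0] h(5)[rule_format, of 1]
    by (auto simp: pathstart_def pathfinish_def)
qed

lemma spin_lift_exists:
  assumes "path g" "path_image g \<subseteq> frames" "pathstart g = base_frame"
  obtains A where "spin_lift g A"
  using covering_space_lift_path_strong[OF covering_space_spin_frame, of "mat 1" g] assms
  unfolding spin_lift_def by (metis Sp11_one spin_frame_one)

lemma spin_lift_monodromy:
  assumes "spin_lift g A" "spin_lift g' B" "homotopic_paths frames g g'"
  shows "A = B"
  using covering_space_monodromy[OF covering_space_spin_frame _ _ _ _ assms(3)]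
    spin_liftD[OF assms(1)] spin_liftD[OF assms(2)] assms(1,2) unfolding spin_lift_def by metis

text \<open>Lifts with common endpoints are homotopic because the group is simply connected, and
  \<open>spin_frame\<close> projects the homotopy. This converse of monodromy is what makes the
  endpoint a complete invariant of a path class.\<close>

lemma homotopic_if_spin_lift:
  assumes "spin_lift g A" "spin_lift g' A"
  shows "homotopic_paths frames g g'"
proof -
  obtain h where h: "path h" "path_image h \<subseteq> Sp11" "pathstart h = mat 1" "pathfinish h = A"
    "\<forall>t\<in>{0..1}. spin_frame (h t) = g t"
    using assms(1) unfolding spin_lift_def by blast
  obtain h' where h': "path h'" "path_image h' \<subseteq> Sp11" "pathstart h' = mat 1" "pathfinish h' = A"
    "\<forall>t\<in>{0..1}. spin_frame (h' t) = g' t"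
    using assms(2) unfolding spin_lift_def by blast
  have "homotopic_paths Sp11 h h'"
    using simply_connected_Sp11 h h' unfolding simply_connected_eq_homotopic_paths by metis
  then have "homotopic_paths frames (spin_frame \<circ> h) (spin_frame \<circ> h')"
    by (rule homotopic_paths_continuous_image) (auto intro!: continuous_intros)
  moreover have "homotopic_paths frames (spin_frame \<circ> h) g"
    using h by (intro homotopic_paths_eq path_continuous_image continuous_intros)
      (auto simp: path_image_compose)
  moreover have "homotopic_paths frames (spin_frame \<circ> h') g'"
    using h' by (intro homotopic_paths_eq path_continuous_image continuous_intros)
      (auto simp: path_image_compose)
  ultimately show ?thesis
    by (meson homotopic_paths_sym homotopic_paths_trans)
qed

lemma pclass_spin_lift:
  assumes "spin_lift g A" shows "pclass g = {g'. spin_lift g' A}"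
proof -
  have "spin_lift g' A" if "homotopic_paths frames g g'" for g'
  proof -
    have "path g'" "path_image g' \<subseteq> frames" "pathstart g' = base_frame"
      using that spin_liftD[OF assms] homotopic_paths_imp_path homotopic_paths_imp_subset
        homotopic_paths_imp_pathstart by metis+
    then obtain B where "spin_lift g' B" by (rule spin_lift_exists)
    then show ?thesis using spin_lift_monodromy[OF assms _ that] by blast
  qed
  then show ?thesis
    using homotopic_if_spin_lift[OF assms] unfolding pclass_def by blast
qed

lemma spin_over_lift:
  assumes "spin_over F S"
  obtains A where "A \<in> Sp11" "spin_frame A = F" "S = {g. spin_lift g A}" "S \<noteq> {}"
proof -
  obtain g where g: "path g" "path_image g \<subseteq> frames" "pathstart g = base_frame"
      "pathfinish g = F" "S = pclass g"
    using assms unfolding spin_over_def by blast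
  then obtain A where A: "spin_lift g A" using spin_lift_exists by blast
  then have "S = {g. spin_lift g A}" using g pclass_spin_lift by blast
  then show ?thesis using that[of A] A g spin_liftD[OF A] by auto
qed

text \<open>The bridge from path classes to algebra: to continue a class along a frame path it
  suffices to exhibit a path in the group above it that starts at A. It serves for curves in a
  horosphere, for the half turn, and for translation followed by rotation.\<close>

lemma spin_lift_join:
  assumes "spin_lift g A" "path h" "path_image h \<subseteq> Sp11" "pathstart h = A"
    "\<And>t. t \<in> {0..1} \<Longrightarrow> f t = spin_frame (h t)"
  shows "spin_lift (g +++ f) (pathfinish h)"
proof -
  obtain k where k: "path k" "path_image k \<subseteq> Sp11" "pathstart k = mat 1" "pathfinish k = A"
    "\<forall>t\<in>{0..1}. spin_frame (k t) = g t"
    using assms(1) unfolding spin_lift_def by blast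
  show ?thesis
    unfolding spin_lift_def
  proof (intro exI[of _ "k +++ h"] conjI)
    show "path (k +++ h)" "path_image (k +++ h) \<subseteq> Sp11" "pathstart (k +++ h) = mat 1"
      "pathfinish (k +++ h) = pathfinish h"
      using k assms by (auto simp: path_image_join)
    show "\<forall>t\<in>{0..1}. spin_frame ((k +++ h) t) = (g +++ f) t"
      using k(5) assms(5) by (auto simp: joinpaths_def)
  qed
qed

section \<open>The spinor of a spin-decorated horosphere\<close>

lemma axis_nth: "axis i x $ j = (if i = j then x else 0)"
  by (simp add: axis_def)

text \<open>In an outward frame the base point plus the normal is the null vector of the horosphere.
  For the base frame that vector is this one, so A carries it to the null vector of the horosphere
  of its own outward frame.\<close>

definition e04 :: "real^5" where "e04 = axis 0 1 + axis 4 1"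

lemma e04_sel [simp]: "e04$0 = 1" "e04$1 = 0" "e04$2 = 0" "e04$3 = 0" "e04$4 = 1"
  by (simp_all add: e04_def axis_nth)

lemma act_e04: "act A e04 = act A (axis 0 1) + act A (axis 4 1)"
  by (simp add: e04_def)

lemma herm_e04: "herm e04 = mat2 1 1 1 1"
  by (simp add: e04_def herm_axis mat2_arith)

lemma mink_linear [simp]:
  "mink (x + y) z = mink x z + mink y z" "mink z (x + y) = mink z x + mink z y"
  "mink (x - y) z = mink x z - mink y z" "mink z (x - y) = mink z x - mink z y"
  "mink (r *\<^sub>R x) z = r * mink x z" "mink z (r *\<^sub>R x) = r * mink z x"
  "mink (- x) z = - mink x z" "mink z (- x) = - mink z x"
  by (simp_all add: mink_def algebra_simps)

lemma mink_e04 [simp]: "mink e04 x = x$0 - x$4" "mink x e04 = x$0 - x$4"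
  by (simp_all add: mink_def)

lemma mink_axis_simps [simp]:
  "mink (axis 0 1) x = x$0" "mink x (axis 0 1) = x$0"
  "mink (axis 4 1) x = - (x$4)" "mink x (axis 4 1) = - (x$4)"
  by (simp_all add: mink_def axis_nth)

text \<open>This is 1 + z n for the real matrix n with rows (1,-1), (1,-1), where n^2 = 0. For
  imaginary z these are the parabolic translations of the horosphere of \<open>e04\<close>; since n
  annihilates (1,1), they do not affect the spinor.\<close>

definition unip :: "quat \<Rightarrow> quat^2^2" where
  "unip z = mat2 (1 + z) (- z) z (1 - z)"

lemma unip_0 [simp]: "unip 0 = mat 1"
  by (simp add: unip_def mat2_arith)

lemma qcnj_imag: "qRe z = 0 \<Longrightarrow> qcnj z = - z"
  by (simp add: quat_eq_iff)

lemma unip_in_Sp11 [simp]: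
  assumes "qRe z = 0" shows "unip z \<in> Sp11"
  unfolding unip_def mat2_in_Sp11 by (simp add: qcnj_imag[OF assms] algebra_simps)

lemma act_unip_e0:
  assumes "qRe z = 0"
  shows "act (unip z) (axis 0 1) = axis 0 1 + vec5 0 (- 2 * qK z) (2 * qJ z) (- 2 * qI z) 0
    + (2 * (norm z)\<^sup>2) *\<^sub>R e04"
  using assms
  by (simp add: vec5_eq_iff act_def unip_def herm_axis mat2_arith unherm_def axis_nth norm_quat_sq algebra_simps)

lemma act_unip_e04:
  assumes "qRe z = 0" shows "act (unip z) e04 = e04"
  unfolding act_def unip_def using assms
  by (simp add: vec5_eq_iff mat2_arith unherm_def herm_e04 qcnj_imag)

text \<open>A tangent vector changes only in the null direction, which is the change that
  parallelism along the horosphere allows. The multiple can be read off the time coordinate, which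
  is 1 for \<open>e04\<close> and 0 for the axis.\<close>

lemma act_unip_axis:
  assumes "qRe z = 0" "i \<noteq> 0" "i \<noteq> 4"
  shows "\<exists>c. act (unip z) (axis i 1) = axis i 1 + c *\<^sub>R e04"
proof (intro exI)
  show "act (unip z) (axis i 1) = axis i 1 + (act (unip z) (axis i 1) $ 0) *\<^sub>R e04"
    using assms exhaust_5[of i]
    by (auto simp: vec5_eq_iff act_def unip_def herm_axis mat2_arith unherm_def axis_nth algebra_simps)
qed

lemma continuous_on_unip [continuous_intros]:
  "continuous_on S f \<Longrightarrow> continuous_on S (\<lambda>x. unip (f x))"
  unfolding unip_def by (intro continuous_intros)

lemma horosphere_unip:
  assumes "A \<in> Sp11" "qRe z = 0"
  shows "act (A ** unip z) (axis 0 1) \<in> horosphere (act A e04)"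
proof -
  have "act A e04 = act (A ** unip z) e04"
    using assms act_unip_e04 by simp
  then have "mink (act (A ** unip z) (axis 0 1)) (act A e04) = mink (axis 0 1) e04"
    using assms mink_act Sp11_mult unip_in_Sp11 by metis
  also have "\<dots> = 1" by (simp add: axis_nth)
  finally show ?thesis using assms by (simp add: horosphere_def del: act_mult)
qed

lemma horosphere_reach:
  assumes "A \<in> Sp11" "y \<in> horosphere (act A e04)"
  obtains z where "qRe z = 0" "act (A ** unip z) (axis 0 1) = y"
proof -
  define y' where "y' = act (ginv A) y"
  have y: "y = act A y'" using assms by (simp add: y'_def)
  have hyp: "y' \<in> hyp" using assms by (simp add: y'_def horosphere_def)
  have "mink y' e04 = 1"
    using assms mink_act[OF assms(1), of y' e04] y by (simp add: horosphere_def del: act_linear_simps)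
  then have d: "y'$0 = 1 + y'$4" by simp
  \<comment> \<open>Solved from \<open>act_unip_e0\<close>, whose coordinates 1, 2, 3 are -2 qK z, 2
    qJ z, -2 qI z. The other two coordinates then agree because y' lies on the hyperboloid and on
    the horosphere.\<close>
  define z where "z = Quat 0 (- y'$3 / 2) (y'$2 / 2) (- y'$1 / 2)"
  have "mink y' y' = 1" using hyp by (simp add: hyp_def)
  then have "2 * (2 * (norm z)\<^sup>2) = 2 * y'$4"
    unfolding mink_def d by (simp add: norm_quat_sq z_def algebra_simps)
  then have n: "2 * (norm z)\<^sup>2 = y'$4" by simp
  have z: "qRe z = 0" by (simp add: z_def)
  have "act (unip z) (axis 0 1) = y'"
    unfolding act_unip_e0[OF z] n by (simp add: vec5_eq_iff z_def d axis_nth)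
  with z show ?thesis using that assms y by simp
qed

section \<open>Parallel fields on a horosphere\<close>

lemma bounded_linear_mink: "bounded_linear (\<lambda>x. mink x y)"
  by (rule linear_conv_bounded_linear[THEN iffD1], rule linearI) simp_all

text \<open>Along the curve \<alpha> the derivative of V lies in the span of the point and p;
  orthogonality of V to p removes the first component, so V varies only by multiples of p. The
  translated axis also differs from V x by a multiple of p, and both are orthogonal to the final
  point, which has product 1 with p. This forces the two multiples to agree.\<close>

lemma parallel_transport:
  assumes A: "A \<in> Sp11" and z: "qRe z = 0" and par: "parallel_field (act A e04) V"
    and tan: "\<And>x. x \<in> horosphere (act A e04) \<Longrightarrow> mink (V x) x = 0 \<and> mink (V x) (act A e04) = 0"
    and V: "V (act A (axis 0 1)) = act A (axis i 1)" and i: "i \<noteq> 0" "i \<noteq> 4"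
  shows "V (act (A ** unip z) (axis 0 1)) = act (A ** unip z) (axis i 1)"
proof -
  define p where "p = act A e04"
  define x where "x = act A (axis 0 1)"
  define \<alpha> where "\<alpha> t = act (A ** unip (t *\<^sub>R z)) (axis 0 1)" for t
  define a where "a = act A (vec5 0 (- 2 * qK z) (2 * qJ z) (- 2 * qI z) 0)"
  have \<alpha>_eq: "\<alpha> t = x + t *\<^sub>R a + t\<^sup>2 *\<^sub>R ((2 * (norm z)\<^sup>2) *\<^sub>R p)" for t
  proof -
    have "vec5 0 (- 2 * qK (t *\<^sub>R z)) (2 * qJ (t *\<^sub>R z)) (- 2 * qI (t *\<^sub>R z)) 0
        = t *\<^sub>R vec5 0 (- 2 * qK z) (2 * qJ z) (- 2 * qI z) 0"
      by (simp add: vec5_eq_iff)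
    then show ?thesis
      using A z by (simp add: \<alpha>_def act_unip_e0 x_def a_def p_def power_mult_distrib mult.commute mult.left_commute
          del: act_linear_simps(1)) (simp add: algebra_simps)
  qed
  have \<alpha>: "\<alpha> t \<in> horosphere p" for t
    using horosphere_unip[OF A, of "t *\<^sub>R z"] z by (simp add: \<alpha>_def p_def)
  have "\<alpha> differentiable at t" for t
  proof -
    have "(\<alpha> has_vector_derivative (a + (2 * t) *\<^sub>R ((2 * (norm z)\<^sup>2) *\<^sub>R p))) (at t)"
      unfolding \<alpha>_eq[abs_def] by (auto intro!: derivative_eq_intros)
    then show ?thesis by (rule differentiableI_vector)
  qed
  with \<alpha> par have "\<exists>d. ((V \<circ> \<alpha>) has_vector_derivative d) (at t) \<and> d \<in> span {\<alpha> t, p}" for t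
    unfolding parallel_field_def p_def by blast
  then obtain d where d: "\<And>t. ((V \<circ> \<alpha>) has_vector_derivative d t) (at t)" "\<And>t. d t \<in> span {\<alpha> t, p}"
    by metis
  have xp: "mink p x = 1"
    using mink_act[OF A, of e04 "axis 0 1"] by (simp add: p_def x_def axis_nth)
  have pp: "mink p p = 0"
    using mink_act[OF A, of e04 e04] by (simp add: p_def axis_nth)
  have dp: "\<exists>c. d t = c *\<^sub>R p" for t
  proof -
    obtain c e where de: "d t = c *\<^sub>R \<alpha> t + e *\<^sub>R p"
      using d(2)[of t] by (auto simp: span_insert span_singleton algebra_simps)
    have "((\<lambda>t. mink ((V \<circ> \<alpha>) t) p) has_vector_derivative mink (d t) p) (at t)"
      by (rule bounded_linear.has_vector_derivative[OF bounded_linear_mink d(1)])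
    moreover have "(\<lambda>t. mink ((V \<circ> \<alpha>) t) p) = (\<lambda>t. 0)"
      using tan \<alpha> by (auto simp: p_def)
    ultimately have "mink (d t) p = 0"
      using vector_derivative_unique_at has_vector_derivative_const by metis
    then have "c = 0" using \<alpha>[of t] pp by (simp add: de horosphere_def)
    then show ?thesis using de by auto
  qed
  \<comment> \<open>As p has product 1 with x, this map annihilates p. Hence L of the field has
    derivative 0 and is constant along \<alpha>.\<close>
  define L where "L v = v - mink v x *\<^sub>R p" for v
  have L: "bounded_linear L"
    by (rule linear_conv_bounded_linear[THEN iffD1], rule linearI) (simp_all add: L_def algebra_simps)
  have "((\<lambda>t. L ((V \<circ> \<alpha>) t)) has_vector_derivative 0) (at t within UNIV)" for t
  proof -
    have "L (d t) = 0" using dp[of t] xp by (auto simp: L_def)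
    then show ?thesis using bounded_linear.has_vector_derivative[OF L d(1)[of t]] by simp
  qed
  then obtain c where "\<And>t. L ((V \<circ> \<alpha>) t) = c"
    using has_vector_derivative_zero_constant[of UNIV "\<lambda>t. L ((V \<circ> \<alpha>) t)"] by auto
  then have "L (V (\<alpha> 1)) = L (V (\<alpha> 0))" by (metis comp_apply)
  moreover have "\<alpha> 0 = x" by (simp add: \<alpha>_eq)
  moreover have "mink (V x) x = 0" using tan \<alpha>[of 0] \<open>\<alpha> 0 = x\<close> by (simp add: p_def)
  ultimately have *: "V (\<alpha> 1) = V x + mink (V (\<alpha> 1)) x *\<^sub>R p"
    by (simp add: L_def algebra_simps)
  obtain c where "act (unip z) (axis i 1) = axis i 1 + c *\<^sub>R e04"
    using act_unip_axis[OF z i] by blast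
  then have **: "act (A ** unip z) (axis i 1) = V x + c *\<^sub>R p"
    using A z V by (simp add: p_def x_def)
  have "mink (V (\<alpha> 1)) (\<alpha> 1) = 0" using tan \<alpha> by (simp add: p_def)
  moreover have "mink (act (A ** unip z) (axis i 1)) (\<alpha> 1) = 0"
    using A z i by (simp add: \<alpha>_def axis_nth del: act_mult)
  moreover have "mink p (\<alpha> 1) = 1" using \<alpha>[of 1] by (simp add: horosphere_def mink_commute)
  ultimately have "mink (V (\<alpha> 1)) x = c"
    unfolding ** by (subst (asm) *) simp
  then show ?thesis
    using * ** by (simp add: \<alpha>_def)
qed

section \<open>Lifts of the outward and inward frame fields\<close>

lemma v1_out_eq:
  assumes "is_frame (x, v, vi x, vj x, N_out p x)" shows "v1_out p vi vj x = v"
  unfolding v1_out_def using assms is_frame_unique by blast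

lemma spin_frame_is_frame: "A \<in> Sp11 \<Longrightarrow> is_frame (spin_frame A)"
  using spin_frame_in_frames by (simp add: frames_def)

text \<open>Two vectors follow by parallelism, and the normal because \<open>unip z\<close> fixes
  \<open>e04\<close>; the remaining one is forced by orthonormality and orientation.\<close>

lemma out_frame_unip:
  assumes "A \<in> Sp11" "qRe z = 0" "decoration p vi vj" "spin_frame A = out_frame p vi vj x"
  shows "spin_frame (A ** unip z) = out_frame p vi vj (act (A ** unip z) (axis 0 1))"
proof -
  let ?y = "act (A ** unip z) (axis 0 1)"
  have x: "x = act A (axis 0 1)" and vx: "vi x = act A (axis 2 1)" "vj x = act A (axis 3 1)"
    and N: "p - x = act A (axis 4 1)"
    using assms(4) by (simp_all add: out_frame_def spin_frame_def N_out_def)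
  then have p: "p = act A e04" unfolding act_e04 x[symmetric] N[symmetric] by simp
  note dec = assms(3)[unfolded decoration_def]
  have v: "vi ?y = act (A ** unip z) (axis 2 1)" "vj ?y = act (A ** unip z) (axis 3 1)"
    using dec vx assms(1,2) unfolding p x by (auto intro!: parallel_transport simp del: act_linear_simps act_mult)
  have "p = act (A ** unip z) e04"
    using assms(1,2) by (simp add: p act_unip_e04 del: act_linear_simps)
  then have "N_out p ?y = act (A ** unip z) (axis 4 1)"
    by (simp add: N_out_def act_e04 del: act_mult)
  then have eq: "spin_frame (A ** unip z) = (?y, act (A ** unip z) (axis 1 1), vi ?y, vj ?y, N_out p ?y)"
    using v by (simp add: spin_frame_def)
  moreover have "is_frame (spin_frame (A ** unip z))"
    using assms by (intro spin_frame_is_frame) simp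
  ultimately have "v1_out p vi vj ?y = act (A ** unip z) (axis 1 1)"
    by (intro v1_out_eq) simp
  then show ?thesis using eq by (simp add: out_frame_def)
qed

text \<open>The lift of the rotation from outward to inward frames. With a = t pi/2, the map w to
  exp(k a) w exp(k a) fixes i and j and turns 1 towards k by 2a = t pi, that is, axis 4 towards axis
  1.\<close>

definition flip :: "real \<Rightarrow> quat^2^2" where
  "flip t = mat2 (Quat (cos (t * pi / 2)) 0 0 (sin (t * pi / 2))) 0 0
     (Quat (cos (t * pi / 2)) 0 0 (- sin (t * pi / 2)))"

lemma flip_in_Sp11 [simp]: "flip t \<in> Sp11"
  unfolding flip_def by (intro diag_in_Sp11) (simp_all add: norm_quat_def inner_quat_def power2_eq_square[symmetric])

lemma flip_path_eq:
  assumes "A \<in> Sp11" "spin_frame A = out_frame p vi vj x"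
  shows "flip_path p vi vj x t = spin_frame (A ** flip t)"
proof -
  have c: "cos (t * pi) = cos (t * pi / 2) * cos (t * pi / 2) - sin (t * pi / 2) * sin (t * pi / 2)"
    "sin (t * pi) = 2 * (sin (t * pi / 2) * cos (t * pi / 2))"
    using cos_double[of "t * pi / 2"] sin_double[of "t * pi / 2"] by (simp_all add: power2_eq_square)
  have s: "cos (t * pi / 2) * cos (t * pi / 2) + sin (t * pi / 2) * sin (t * pi / 2) = 1"
    using sin_cos_squared_add2[of "t * pi / 2"] by (simp add: power2_eq_square add.commute)
  let ?n = "norm (Quat (cos (t * pi / 2)) 0 0 (sin (t * pi / 2))) = 1"
    and ?n' = "norm (Quat (cos (t * pi / 2)) 0 0 (- sin (t * pi / 2))) = 1"
  have n: ?n ?n' by (simp_all add: norm_quat_def inner_quat_def power2_eq_square[symmetric])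
  have f: "act (flip t) (axis 0 1) = axis 0 1"
    "act (flip t) (axis 1 1) = cos (t * pi) *\<^sub>R axis 1 1 - sin (t * pi) *\<^sub>R axis 4 1"
    "act (flip t) (axis 2 1) = axis 2 1" "act (flip t) (axis 3 1) = axis 3 1"
    "act (flip t) (axis 4 1) = cos (t * pi) *\<^sub>R axis 4 1 + sin (t * pi) *\<^sub>R axis 1 1"
    unfolding flip_def c vec5_eq_wq_iff act_diag[OF n] wq_axis using s
    by (simp_all add: axis_nth quat_eq_iff algebra_simps)
  then show ?thesis
    using assms by (simp add: flip_path_def spin_frame_def out_frame_def f)
qed

section \<open>Spinors and cospinors of a group element\<close>

definition rmul :: "quat^2 \<Rightarrow> quat \<Rightarrow> quat^2" where "rmul u q = (\<chi> i. u$i * q)"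

definition spinor :: "quat^2^2 \<Rightarrow> quat^2" where "spinor A = (\<chi> i. A$i$1 + A$i$2)"
definition cospinor :: "quat^2^2 \<Rightarrow> quat^2" where "cospinor A = (\<chi> i. A$i$1 - A$i$2)"

lemma spinor_unip: "spinor (A ** unip z) = spinor A"
  by (cases A rule: mat2_cases; hypsubst) (simp add: spinor_def unip_def mat2_arith vec_eq_iff forall_2 algebra_simps)

text \<open>At t = 1 the flip is diag(k, -k), which takes (1,-1) to (k,k) = (1,1) k. So one spinor
  describes both lifts of a spin decoration.\<close>

lemma cospinor_flip: "cospinor (A ** flip 1) = rmul (spinor A) qk"
proof -
  have "Quat 0 0 0 (- 1) = - qk" by (simp add: quat_eq_iff)
  then show ?thesis
    by (cases A rule: mat2_cases; hypsubst)
      (simp add: spinor_def cospinor_def rmul_def flip_def mat2_arith vec_eq_iff forall_2 algebra_simps)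
qed

lemma continuous_on_flip [continuous_intros]: "continuous_on S flip"
  unfolding flip_def by (intro continuous_intros) simp_all

text \<open>The path t to \<open>A ** unip (t *\<^sub>R z)\<close> lies above the outward frames
  along a curve from x to y. The continuity condition and uniqueness of the endpoint therefore give
  \<open>B = A ** unip z\<close>.\<close>

lemma spinor_eq_on_horosphere:
  assumes S: "spin_decorated S" and x: "x \<in> horosphere (hpt S)"
    and A: "A \<in> Sp11" "spin_frame A = out_frame (hpt S) (hvi S) (hvj S) x" "Wout S x = {g. spin_lift g A}" "Wout S x \<noteq> {}"
    and y: "y \<in> horosphere (hpt S)"
    and B: "B \<in> Sp11" "Wout S y = {g. spin_lift g B}"
  shows "spinor B = spinor A"
proof -
  let ?of = "out_frame (hpt S) (hvi S) (hvj S)"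
  have dec: "decoration (hpt S) (hvi S) (hvj S)"
    and cont: "\<And>\<alpha> g. \<lbrakk>path \<alpha>; path_image \<alpha> \<subseteq> horosphere (hpt S); pathstart \<alpha> = x; pathfinish \<alpha> = y; g \<in> Wout S x\<rbrakk>
      \<Longrightarrow> g +++ (?of \<circ> \<alpha>) \<in> Wout S y"
    using S unfolding spin_decorated_def Let_def by blast+
  have xA: "x = act A (axis 0 1)" and p: "hpt S = act A e04"
    using A(2) by (simp_all add: out_frame_def spin_frame_def N_out_def act_e04)
  obtain z where z: "qRe z = 0" "act (A ** unip z) (axis 0 1) = y"
    using horosphere_reach[OF A(1)] y unfolding p by blast
  define h where "h t = A ** unip (t *\<^sub>R z)" for t
  define \<alpha> where "\<alpha> t = act (h t) (axis 0 1)" for t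
  have h: "h t \<in> Sp11" for t using A z by (simp add: h_def)
  have \<alpha>h: "\<alpha> t \<in> horosphere (hpt S)" for t
    unfolding p \<alpha>_def h_def using A z by (intro horosphere_unip) auto
  have path: "path h" "path \<alpha>"
    unfolding path_def \<alpha>_def h_def by (intro continuous_intros)+
  obtain g where g: "g \<in> Wout S x" using A(4) by blast
  then have "g +++ (?of \<circ> \<alpha>) \<in> Wout S y"
    using path \<alpha>h by (intro cont) (auto simp: path_image_def pathstart_def pathfinish_def \<alpha>_def h_def z xA[symmetric])
  moreover have "spin_lift (g +++ (?of \<circ> \<alpha>)) (pathfinish h)"
  proof (rule spin_lift_join)
    show "spin_lift g A" using g A by blast
    show "path h" "path_image h \<subseteq> Sp11" "pathstart h = A"
      using path h by (auto simp: path_image_def pathstart_def h_def)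
    show "(?of \<circ> \<alpha>) t = spin_frame (h t)" for t
      using out_frame_unip[OF A(1) _ dec A(2), of "t *\<^sub>R z"] z by (simp add: h_def \<alpha>_def)
  qed
  ultimately have "B = pathfinish h"
    using B spin_lift_monodromy homotopic_if_spin_lift by blast
  then show ?thesis by (simp add: pathfinish_def h_def spinor_unip)
qed

lemma spin_decorated_spinor:
  assumes S: "spin_decorated S"
  obtains \<kappa> where
    "\<And>x. x \<in> horosphere (hpt S) \<Longrightarrow> \<exists>A\<in>Sp11. spin_frame A = out_frame (hpt S) (hvi S) (hvj S) x \<and>
       Wout S x = {g. spin_lift g A} \<and> spinor A = \<kappa>"
    "\<And>x. x \<in> horosphere (hpt S) \<Longrightarrow> \<exists>A\<in>Sp11. spin_frame A = in_frame (hpt S) (hvi S) (hvj S) x \<and>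
       Win S x = {g. spin_lift g A} \<and> Win S x \<noteq> {} \<and> cospinor A = rmul \<kappa> qk"
proof -
  let ?of = "out_frame (hpt S) (hvi S) (hvj S)" and ?if = "in_frame (hpt S) (hvi S) (hvj S)"
  have spin: "\<And>x. x \<in> horosphere (hpt S) \<Longrightarrow> spin_over (?of x) (Wout S x)"
    "\<And>x. x \<in> horosphere (hpt S) \<Longrightarrow> spin_over (?if x) (Win S x)"
    and fl: "\<And>x g. \<lbrakk>x \<in> horosphere (hpt S); g \<in> Wout S x\<rbrakk> \<Longrightarrow> g +++ flip_path (hpt S) (hvi S) (hvj S) x \<in> Win S x"
    using S unfolding spin_decorated_def Let_def by blast+
  have "\<exists>A. A \<in> Sp11 \<and> spin_frame A = ?of x \<and> Wout S x = {g. spin_lift g A} \<and> Wout S x \<noteq> {}"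
    if "x \<in> horosphere (hpt S)" for x
    using spin(1)[OF that] spin_over_lift by metis
  then obtain A where A: "\<And>x. x \<in> horosphere (hpt S) \<Longrightarrow>
      A x \<in> Sp11 \<and> spin_frame (A x) = ?of x \<and> Wout S x = {g. spin_lift g (A x)} \<and> Wout S x \<noteq> {}"
    by metis
  \<comment> \<open>The reference point is arbitrary; \<open>spinor_eq_on_horosphere\<close>
    compares every other point with it.\<close>
  define \<kappa> where "\<kappa> = spinor (A (SOME x. x \<in> horosphere (hpt S)))"
  have \<kappa>: "spinor (A x) = \<kappa>" if x: "x \<in> horosphere (hpt S)" for x
  proof -
    have s: "(SOME x. x \<in> horosphere (hpt S)) \<in> horosphere (hpt S)"
      using x by (rule someI)
    show ?thesis
      unfolding \<kappa>_def
      by (rule spinor_eq_on_horosphere[OF S s _ _ _ _ x]) (use A[OF s] A[OF x] in blast)+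
  qed
  show ?thesis
  proof (rule that)
    show "\<exists>A\<in>Sp11. spin_frame A = ?of x \<and> Wout S x = {g. spin_lift g A} \<and> spinor A = \<kappa>"
      if "x \<in> horosphere (hpt S)" for x
      using A[OF that] \<kappa>[OF that] by blast
    show "\<exists>A\<in>Sp11. spin_frame A = ?if x \<and> Win S x = {g. spin_lift g A} \<and> Win S x \<noteq> {} \<and> cospinor A = rmul \<kappa> qk"
      if x: "x \<in> horosphere (hpt S)" for x
    proof -
      obtain B where B: "B \<in> Sp11" "spin_frame B = ?if x" "Win S x = {g. spin_lift g B}" "Win S x \<noteq> {}"
        using spin(2)[OF x] spin_over_lift by metis
      obtain g where g: "g \<in> Wout S x" using A[OF x] by blast
      define h where "h t = A x ** flip t" for t
      have "spin_lift (g +++ flip_path (hpt S) (hvi S) (hvj S) x) (pathfinish h)"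
      proof (rule spin_lift_join)
        show "spin_lift g (A x)" using g A[OF x] by blast
        show "path h" unfolding path_def h_def by (intro continuous_intros)
        show "path_image h \<subseteq> Sp11" using A[OF x] by (auto simp: path_image_def h_def)
        have "flip 0 = mat 1" by (simp add: flip_def mat2_arith quat_eq_iff)
        then show "pathstart h = A x" by (simp add: pathstart_def h_def)
        show "flip_path (hpt S) (hvi S) (hvj S) x t = spin_frame (h t)" for t
          using A[OF x] by (simp add: flip_path_eq h_def)
      qed
      moreover have "spin_lift (g +++ flip_path (hpt S) (hvi S) (hvj S) x) B"
        using fl[OF x g] B by blast
      ultimately have "B = A x ** flip 1"
        using spin_lift_monodromy homotopic_if_spin_lift unfolding pathfinish_def h_def by blast
      then show ?thesis using B \<kappa>[OF x] by (auto simp: cospinor_flip intro!: bexI[of _ B])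
    qed
  qed
qed

section \<open>The form on spinors\<close>

definition sform :: "quat^2 \<Rightarrow> quat^2 \<Rightarrow> quat" where
  "sform u v = qcnj (u$1) * v$1 - qcnj (u$2) * v$2"

lemma qcnj_eq_0 [simp]: "qcnj x = 0 \<longleftrightarrow> x = 0"
  by (simp add: quat_eq_iff)

lemma sform_commute: "sform v u = qcnj (sform u v)"
  by (simp add: sform_def)

lemma sform_rmul_left: "sform (rmul u p) v = qcnj p * sform u v"
  and sform_rmul_right: "sform u (rmul v p) = sform u v * p"
  by (simp_all add: sform_def rmul_def algebra_simps)

lemma sform_diff: "sform u (v - w) = sform u v - sform u w"
  by (simp add: sform_def algebra_simps)

text \<open>Invariance of the form under the group. The mixed version with \<open>cospinor\<close>
  is the one lambda lengths call for, as translation starts from an inward frame and ends at an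
  outward one.\<close>

lemma sform_spinors:
  assumes "A \<in> Sp11"
  shows "sform (spinor A) (spinor (A ** B)) = sform (spinor (mat 1)) (spinor B)"
    "sform (cospinor A) (spinor (A ** B)) = sform (cospinor (mat 1)) (spinor B)"
proof -
  have *: "sform (spinor A) (spinor B) = M$1$1 + M$1$2 + M$2$1 + M$2$2"
    "sform (cospinor A) (spinor B) = M$1$1 + M$1$2 - M$2$1 - M$2$2"
    if "M = madj A ** Kmat ** B" for A B M
    unfolding that by (cases A rule: mat2_cases; cases B rule: mat2_cases; hypsubst;
        simp add: spinor_def cospinor_def sform_def Kmat_def mat2_arith algebra_simps)+
  have "madj A ** Kmat ** (A ** B) = madj (mat 1) ** Kmat ** B"
    using assms by (simp add: Sp11_def matrix_mul_assoc)
  then show "sform (spinor A) (spinor (A ** B)) = sform (spinor (mat 1)) (spinor B)"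
    "sform (cospinor A) (spinor (A ** B)) = sform (cospinor (mat 1)) (spinor B)"
    using * by metis+
qed

lemma spinor_one: "spinor (mat 1) $ i = 1"
  using exhaust_2[of i] by (auto simp: spinor_def mat2_arith)

lemma sform_spinor_self: "A \<in> Sp11 \<Longrightarrow> sform (spinor A) (spinor A) = 0"
  using sform_spinors(1)[of A "mat 1"] by (simp add: sform_def spinor_one)

text \<open>The matrix of \<open>e04\<close> is the column (1,1) times its adjoint, so that of
  \<open>act D e04\<close> is the spinor of D times its adjoint. Once A is moved to the identity,
  both sides equal |x - y|^2 for the entries x, y of that spinor, where |x| = |y|. The identity
  decides when a pairing vanishes.\<close>

lemma norm_sform_spinor:
  assumes "A \<in> Sp11" "B \<in> Sp11"
  shows "(norm (sform (spinor A) (spinor B)))\<^sup>2 = 2 * mink (act A e04) (act B e04)"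
proof -
  define D where "D = ginv A ** B"
  have D: "D \<in> Sp11" "B = A ** D" using assms by (simp_all add: D_def)
  obtain a b c d where abcd: "D = mat2 a b c d" by (rule mat2_cases)
  have sf: "sform (spinor A) (spinor B) = (a + b) - (c + d)"
    using assms D sform_spinors(1)[of A D] by (simp add: sform_def spinor_one) (simp add: spinor_def abcd)
  define y where "y = act D e04"
  have h: "herm y = D ** mat2 1 1 1 1 ** madj D"
    using D by (simp add: y_def herm_act herm_e04)
  have "herm y $ 1 $ 1 = (a + b) * qcnj (a + b)" "herm y $ 2 $ 2 = (c + d) * qcnj (c + d)"
    "herm y $ 1 $ 2 = (a + b) * qcnj (c + d)"
    unfolding h abcd by (simp_all add: mat2_arith algebra_simps)
  then have "of_real (y$0) = (a + b) * qcnj (a + b)" "of_real (y$0) = (c + d) * qcnj (c + d)"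
    "wq y = (a + b) * qcnj (c + d)"
    unfolding herm_def mat2_sel .
  then have y: "y$0 = (norm (a + b))\<^sup>2" "y$0 = (norm (c + d))\<^sup>2" "wq y = (a + b) * qcnj (c + d)"
    by (simp_all only: mult_qcnj of_real_eq_iff)
  have "y$4 = inner (a + b) (c + d)"
    using arg_cong[OF y(3), of qRe] by (simp add: inner_quat_def algebra_simps)
  moreover have "mink (act A e04) (act B e04) = y$0 - y$4"
    using assms D by (simp add: y_def del: mink_e04) simp
  ultimately show ?thesis
    unfolding sf using y(1,2) by (simp add: power2_norm_eq_inner inner_diff_left inner_diff_right inner_commute)
qed

text \<open>Two isotropic vectors with nonzero pairing form a basis of the right vector space of
  quaternion pairs; expanding \<open>u2\<close> in the basis \<open>u1, u3\<close> gives the relation.\<close>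

lemma sform_ptolemy:
  assumes "sform u1 u1 = 0" "sform u3 u3 = 0" "sform u1 u3 \<noteq> 0"
  shows "sform u0 u2 = sform u0 u1 * inverse (sform u3 u1) * sform u3 u2
    + sform u0 u3 * inverse (sform u1 u3) * sform u1 u2"
proof -
  have nz: "sform u3 u1 \<noteq> 0"
    using assms(3) sform_commute[of u3 u1] qcnj_eq_iff[of "sform u1 u3" 0] by simp
  \<comment> \<open>The coefficients come from pairing u2 with the opposite basis vector: since u1
    and u3 are isotropic, pairing with u3 sees only the u1-part, and conversely.\<close>
  define w where "w = u2 - rmul u1 (inverse (sform u3 u1) * sform u3 u2) - rmul u3 (inverse (sform u1 u3) * sform u1 u2)"
  have "sform u1 w = 0" "sform u3 w = 0"
    using assms nz by (simp_all add: w_def sform_diff sform_rmul_right mult.assoc[symmetric])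
  then have e: "qcnj (u1$1) * w$1 = qcnj (u1$2) * w$2" "qcnj (u3$1) * w$1 = qcnj (u3$2) * w$2"
    by (simp_all add: sform_def)
  have n: "norm (u1$1) = norm (u1$2)" "norm (u3$1) = norm (u3$2)"
    using assms(1,2) by (simp_all only: sform_def mult_qcnj right_minus_eq of_real_eq_iff)
      (simp_all add: power2_eq_iff_nonneg)
  have u: "u1$1 \<noteq> 0" "u3$1 \<noteq> 0"
    using n assms(3) by (auto simp: sform_def)
  \<comment> \<open>Nondegeneracy by hand. Otherwise the ratio t of the entries of w would be a unit
    quaternion carrying conj(u$1) to conj(u$2) for both u1 and u3, and then these two would be
    orthogonal.\<close>
  have w2: "w$2 = 0"
  proof (rule ccontr)
    assume w: "w$2 \<noteq> 0"
    define t where "t = w$1 * inverse (w$2)"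
    have t: "qcnj (u1$1) * t = qcnj (u1$2)" "qcnj (u3$1) * t = qcnj (u3$2)"
      using e w by (simp_all add: t_def mult.assoc[symmetric]) (simp_all add: mult.assoc)
    have "norm (qcnj (u1$1) * t) = norm (u1$2)" using t by simp
    moreover have "u1$2 \<noteq> 0" using n u by auto
    ultimately have "norm t = 1" using n by (simp add: norm_mult)
    have "u3$2 = qcnj t * u3$1" using arg_cong[OF t(2), of qcnj] by simp
    then have "qcnj (u1$2) * u3$2 = qcnj (u1$1) * (t * qcnj t) * u3$1"
      unfolding t(1)[symmetric] by (simp add: mult.assoc)
    then have "sform u1 u3 = 0" using \<open>norm t = 1\<close> by (simp add: sform_def)
    then show False using assms by simp
  qed
  then have "w$1 = 0" using e(1) u by simp
  then have "sform u0 w = 0" using w2 by (simp add: sform_def)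
  moreover have "sform u0 w = sform u0 u2 - sform u0 u1 * (inverse (sform u3 u1) * sform u3 u2)
      - sform u0 u3 * (inverse (sform u1 u3) * sform u1 u2)"
    by (simp only: w_def sform_diff sform_rmul_right)
  ultimately show ?thesis
    by (simp add: algebra_simps)
qed

section \<open>Lambda lengths in terms of spinors\<close>

lemma lightcone_wq:
  assumes "c \<in> lightcone" shows "norm (wq c) = c$0" "c$0 > 0"
proof -
  show "c$0 > 0" using assms by (simp add: lightcone_def)
  have "inner (wq c) (wq c) = (c$0)\<^sup>2"
    using assms by (simp add: lightcone_def mink_wq power2_eq_square)
  then have "(norm (wq c))\<^sup>2 = (c$0)\<^sup>2"
    by (simp only: power2_norm_eq_inner)
  then show "norm (wq c) = c$0" using \<open>c$0 > 0\<close> by (simp add: power2_eq_iff_nonneg)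
qed

text \<open>For null vectors the product is the defect in the Cauchy-Schwarz inequality of their
  spatial parts. Equality makes these positively proportional, and then the centres
  coincide.\<close>

lemma mink_lightcone_pos:
  assumes "c1 \<in> lightcone" "c2 \<in> lightcone" "\<not> same_centre c1 c2"
  shows "mink c1 c2 > 0"
proof -
  note w = lightcone_wq[OF assms(1)] lightcone_wq[OF assms(2)]
  have "mink c1 c2 = norm (wq c1) * norm (wq c2) - inner (wq c1) (wq c2)"
    using w by (simp add: mink_wq)
  moreover have "inner (wq c1) (wq c2) \<noteq> norm (wq c1) * norm (wq c2)"
  proof
    assume "inner (wq c1) (wq c2) = norm (wq c1) * norm (wq c2)"
    then have eq: "c1$0 *\<^sub>R wq c2 = c2$0 *\<^sub>R wq c1"
      unfolding norm_cauchy_schwarz_eq using w by simp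
    have "wq c2 = (1 / c1$0) *\<^sub>R (c1$0 *\<^sub>R wq c2)" using w by simp
    then have "wq c2 = (c2$0 / c1$0) *\<^sub>R wq c1" unfolding eq by simp
    then have "c2 = (c2$0 / c1$0) *\<^sub>R c1"
      using w unfolding vec5_eq_wq_iff by (simp add: wq_scaleR)
    then show False using assms(3) w unfolding same_centre_def by (metis divide_pos_pos)
  qed
  ultimately show ?thesis using norm_cauchy_schwarz[of "wq c1" "wq c2"] by simp
qed

text \<open>For a point a c1 + b c2 with m = mink c1 c2, the horosphere gives b m = 1 and the
  hyperboloid gives 2 a b m = 1. The tangent turns out to be the inward normal of the first
  horosphere, so the inward frame at the foot already has the direction of the geodesic as its last
  vector.\<close>

lemma foot_gtan:
  assumes "c1 \<in> lightcone" "c2 \<in> lightcone" "\<not> same_centre c1 c2"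
  shows foot_eq: "foot c1 c2 = (1 / 2) *\<^sub>R c1 + (1 / mink c1 c2) *\<^sub>R c2"
    and foot_in_horosphere: "foot c1 c2 \<in> horosphere c1"
    and gtan_eq: "gtan c1 c2 (foot c1 c2) = foot c1 c2 - c1"
proof -
  define m where "m = mink c1 c2"
  have m: "m > 0" "mink c1 c2 = m" "mink c2 c1 = m"
    using mink_lightcone_pos[OF assms] by (simp_all add: m_def mink_commute)
  have z: "mink c1 c1 = 0" "mink c2 c2 = 0" "c1$0 > 0" "c2$0 > 0"
    using assms by (simp_all add: lightcone_def)
  let ?x = "(1 / 2) *\<^sub>R c1 + (1 / m) *\<^sub>R c2"
  have x: "?x \<in> horosphere c1"
    using m z by (simp add: horosphere_def hyp_def add_pos_pos)
  have f: "foot c1 c2 = ?x"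
    unfolding foot_def
  proof (rule the_equality)
    show "?x \<in> horosphere c1 \<and> (\<exists>a b. a > 0 \<and> b > 0 \<and> ?x = a *\<^sub>R c1 + b *\<^sub>R c2)"
      using x m by (metis half_gt_zero zero_less_divide_1_iff zero_less_one)
    fix x assume "x \<in> horosphere c1 \<and> (\<exists>a b. a > 0 \<and> b > 0 \<and> x = a *\<^sub>R c1 + b *\<^sub>R c2)"
    then obtain a b where ab: "x = a *\<^sub>R c1 + b *\<^sub>R c2" "mink x c1 = 1" "mink x x = 1"
      by (auto simp: horosphere_def hyp_def)
    then have b: "b * m = 1" using m z by simp
    have "2 * a * (b * m) = 1" using ab m z by (simp add: algebra_simps)
    then have "a = 1 / 2" "b = 1 / m" using b m by (simp_all add: field_simps)
    then show "x = ?x" using ab(1) by simp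
  qed
  then show "foot c1 c2 = (1 / 2) *\<^sub>R c1 + (1 / mink c1 c2) *\<^sub>R c2" "foot c1 c2 \<in> horosphere c1"
    using x m by simp_all
  show "gtan c1 c2 (foot c1 c2) = foot c1 c2 - c1"
    unfolding gtan_def f
  proof (rule the_equality)
    have "?x - c1 = (- (1 / 2)) *\<^sub>R c1 + (1 / m) *\<^sub>R c2"
      by (simp add: vec_eq_iff)
    moreover have "1 / m > 0" using m by simp
    ultimately have "\<exists>a b. b > 0 \<and> ?x - c1 = a *\<^sub>R c1 + b *\<^sub>R c2" by blast
    then show "mink (?x - c1) ?x = 0 \<and> mink (?x - c1) (?x - c1) = - 1 \<and>
        (\<exists>a b. b > 0 \<and> ?x - c1 = a *\<^sub>R c1 + b *\<^sub>R c2)"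
      using m z by simp
    fix T assume "mink T ?x = 0 \<and> mink T T = - 1 \<and> (\<exists>a b. b > 0 \<and> T = a *\<^sub>R c1 + b *\<^sub>R c2)"
    then obtain a b where ab: "T = a *\<^sub>R c1 + b *\<^sub>R c2" "b > 0" "mink T ?x = 0" "mink T T = - 1"
      by blast
    then have a: "a = - (b * m / 2)" using m z by (simp add: field_simps)
    have "mink T T = 2 * a * b * m" unfolding ab(1) using m z by (simp add: algebra_simps)
    then have "(b * m)\<^sup>2 = 1" using ab(4) by (simp add: a power2_eq_square algebra_simps)
    then have "b * m = 1" using ab m by (simp add: power2_eq_1_iff) (smt (verit) mult_pos_pos)
    then have "a = - 1 / 2" "b = 1 / m" using a m by (simp_all add: field_simps)
    then show "T = ?x - c1" using ab(1) by (simp add: vec_eq_iff)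
  qed
qed

lemma horosphere_nonempty:
  assumes "c \<in> lightcone" shows "\<exists>x. x \<in> horosphere c"
proof -
  \<comment> \<open>The opposite null direction; the geodesic joining the two centres meets the
    horosphere.\<close>
  define c' where "c' = vec5 (c$0) (- c$1) (- c$2) (- c$3) (- c$4)"
  have c': "c' \<in> lightcone" using assms by (simp add: c'_def lightcone_def mink_def)
  have "\<not> same_centre c c'"
  proof
    assume "same_centre c c'"
    then obtain r where r: "r > 0" "c' = r *\<^sub>R c" unfolding same_centre_def by blast
    have "c$0 = r * c$0" using arg_cong[OF r(2), of "\<lambda>x. x$0"] by (simp add: c'_def)
    then have "r = 1" using assms by (simp add: lightcone_def)
    then have "wq c = 0"
      using r(2) by (simp add: quat_eq_iff c'_def vec5_eq_iff)
    then show False using lightcone_wq[OF assms] by simp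
  qed
  then show ?thesis using foot_in_horosphere[OF assms c'] by blast
qed

section \<open>Lifts of translations and rotations along a geodesic\<close>

definition boost :: "real \<Rightarrow> quat^2^2" where
  "boost s = mat2 (of_real (cosh (s / 2))) (of_real (sinh (s / 2))) (of_real (sinh (s / 2))) (of_real (cosh (s / 2)))"

lemma cosh_sinh_sq: "cosh x * cosh x - sinh x * sinh x = 1" for x :: real
  using cosh_square_eq[of x] by (simp add: power2_eq_square)

lemma boost_in_Sp11 [simp]: "boost s \<in> Sp11"
  unfolding boost_def mat2_in_Sp11 using cosh_sinh_sq[of "s / 2"]
  by (simp add: quat_eq_iff mult.commute)

lemma boost_0 [simp]: "boost 0 = mat 1"
  by (simp add: boost_def mat2_arith)

lemma act_boost:
  "act (boost s) (axis 0 1) = cosh s *\<^sub>R axis 0 1 + sinh s *\<^sub>R axis 4 1"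
  "act (boost s) (axis 4 1) = sinh s *\<^sub>R axis 0 1 + cosh s *\<^sub>R axis 4 1"
  "act (boost s) (axis 1 1) = axis 1 1"
  "act (boost s) (axis 2 1) = axis 2 1"
  "act (boost s) (axis 3 1) = axis 3 1"
proof -
  have c: "cosh s = cosh (s / 2) * cosh (s / 2) + sinh (s / 2) * sinh (s / 2)"
    "sinh s = 2 * (sinh (s / 2) * cosh (s / 2))"
    using cosh_double[of "s / 2"] sinh_double[of "s / 2"] by (simp_all add: power2_eq_square)
  show "act (boost s) (axis 0 1) = cosh s *\<^sub>R axis 0 1 + sinh s *\<^sub>R axis 4 1"
    "act (boost s) (axis 4 1) = sinh s *\<^sub>R axis 0 1 + cosh s *\<^sub>R axis 4 1"
    "act (boost s) (axis 1 1) = axis 1 1" "act (boost s) (axis 2 1) = axis 2 1"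
    "act (boost s) (axis 3 1) = axis 3 1"
    using cosh_sinh_sq[of "s / 2"] unfolding c
    by (simp_all add: vec5_eq_iff act_def boost_def herm_axis mat2_arith unherm_def axis_nth algebra_simps)
qed

lemma boost_frame_spin_frame:
  assumes "A \<in> Sp11" "x = act A (axis 0 1)" "T = act A (axis 4 1)"
  shows "boost_frame x T s (spin_frame A) = spin_frame (A ** boost s)"
  using assms by (simp add: boost_frame_def boostv_def spin_frame_def Let_def act_boost axis_nth)

text \<open>The unit quaternion exp(phi v k / 2), with v read as a paravector. The half angle gives
  it period 4 pi in phi.\<close>

definition rotor :: "real^3 \<Rightarrow> real \<Rightarrow> quat" where
  "rotor v \<phi> = Quat (cos (\<phi> / 2)) (sin (\<phi> / 2) * v$3) (- sin (\<phi> / 2) * v$2) (sin (\<phi> / 2) * v$1)"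

lemma norm3: "norm v = 1 \<longleftrightarrow> v$1 * v$1 + v$2 * v$2 + v$3 * v$3 = 1" for v :: "real^3"
  by (simp add: norm_eq_sqrt_inner inner_vec_def sum_3)

lemma norm_rotor [simp]:
  assumes "norm v = 1" shows "norm (rotor v \<phi>) = 1"
proof -
  have "(norm (rotor v \<phi>))\<^sup>2 = (cos (\<phi> / 2))\<^sup>2 + (sin (\<phi> / 2))\<^sup>2 * (v$1 * v$1 + v$2 * v$2 + v$3 * v$3)"
    unfolding norm_quat_sq rotor_def by (simp add: power2_eq_square algebra_simps)
  then show ?thesis
    using assms unfolding norm3 by (simp add: power2_eq_1_iff) (metis norm_ge_zero not_one_le_zero neg_0_le_iff_le)
qed

definition rotation :: "real^3 \<Rightarrow> real \<Rightarrow> quat^2^2" where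
  "rotation v \<phi> = mat2 (rotor v \<phi>) 0 0 (rotor v \<phi>)"

lemma rotation_in_Sp11 [simp]: "norm v = 1 \<Longrightarrow> rotation v \<phi> \<in> Sp11"
  by (simp add: rotation_def)

lemma rotation_0 [simp]: "rotation v 0 = mat 1"
  by (simp add: rotation_def rotor_def mat2_arith quat_eq_iff)

lemma rot_frame_spin_frame:
  assumes "A \<in> Sp11" and v: "norm v = 1"
  shows "rot_frame v \<phi> (spin_frame A) = spin_frame (A ** rotation v \<phi>)"
proof -
  define C S where "C = cos (\<phi> / 2)" and "S = sin (\<phi> / 2)"
  have c: "cos \<phi> = C * C - S * S" "sin \<phi> = 2 * (S * C)"
    using cos_double[of "\<phi> / 2"] sin_double[of "\<phi> / 2"] by (simp_all add: power2_eq_square C_def S_def)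
  have CS: "C * C = 1 - S * S"
    using sin_cos_squared_add2[of "\<phi> / 2"] by (simp add: power2_eq_square C_def S_def algebra_simps)
  obtain x y z where xyz: "x = v$1" "y = v$2" "z = v$3" by blast
  have v3: "x * x = 1 - y * y - z * z" using v unfolding norm3 xyz by linarith
  \<comment> \<open>Rodrigues' rotation formula in half-angle form, with 1 - cos \<phi> = 2 S^2 and
    sin \<phi> = 2 S C.\<close>
  have act_rot: "act (rotation v \<phi>) (axis 0 1) = axis 0 1"
    "act (rotation v \<phi>) (axis 4 1) = axis 4 1"
    "act (rotation v \<phi>) (axis 1 1) = (1 - 2 * (S * S) * (1 - x * x)) *\<^sub>R axis 1 1 +
      (2 * (S * C) * z + 2 * (S * S) * (x * y)) *\<^sub>R axis 2 1 + (- 2 * (S * C) * y + 2 * (S * S) * (x * z)) *\<^sub>R axis 3 1"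
    "act (rotation v \<phi>) (axis 2 1) = (- 2 * (S * C) * z + 2 * (S * S) * (x * y)) *\<^sub>R axis 1 1 +
      (1 - 2 * (S * S) * (1 - y * y)) *\<^sub>R axis 2 1 + (2 * (S * C) * x + 2 * (S * S) * (y * z)) *\<^sub>R axis 3 1"
    "act (rotation v \<phi>) (axis 3 1) = (2 * (S * C) * y + 2 * (S * S) * (x * z)) *\<^sub>R axis 1 1 +
      (- 2 * (S * C) * x + 2 * (S * S) * (y * z)) *\<^sub>R axis 2 1 + (1 - 2 * (S * S) * (1 - z * z)) *\<^sub>R axis 3 1"
    unfolding vec5_eq_wq_iff rotation_def act_diag[OF norm_rotor[OF v] norm_rotor[OF v]] wq_add wq_scaleR wq_axis
    unfolding rotor_def C_def[symmetric] S_def[symmetric] xyz[symmetric]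
    by (auto simp: axis_nth quat_eq_iff CS v3 algebra_simps)
  show ?thesis
    using assms
    by (simp add: rot_frame_def spin_frame_def act_rot rotv_def Let_def c CS cross3_def xyz mink_axis
        inner_vec_def sum_3 axis_nth) (simp add: algebra_simps)
qed

lemma qexp_rotor:
  assumes "norm v = 1"
  shows "qexp (Quat (\<rho> / 2) (\<theta> * v$3 / 2) (- \<theta> * v$2 / 2) (\<theta> * v$1 / 2)) = exp (\<rho> / 2) *\<^sub>R rotor v \<theta>"
proof -
  have "(\<theta> * v$3 / 2)\<^sup>2 + (- \<theta> * v$2 / 2)\<^sup>2 + (\<theta> * v$1 / 2)\<^sup>2 = (\<theta> / 2)\<^sup>2 * (v$1 * v$1 + v$2 * v$2 + v$3 * v$3)"
    by (simp add: power2_eq_square algebra_simps)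
  then have r: "sqrt ((\<theta> * v$3 / 2)\<^sup>2 + (- \<theta> * v$2 / 2)\<^sup>2 + (\<theta> * v$1 / 2)\<^sup>2) = \<bar>\<theta> / 2\<bar>"
    using assms unfolding norm3 by simp
  \<comment> \<open>For \<theta> = 0 the quotient is 0/0 = 0, which is harmless since it is
    multiplied by \<theta>; for negative \<theta> the parity of cos and sin removes the absolute
    value.\<close>
  have s: "cos \<bar>\<theta> / 2\<bar> = cos (\<theta> / 2)" "sin \<bar>\<theta> / 2\<bar> / \<bar>\<theta> / 2\<bar> * (\<theta> / 2) = sin (\<theta> / 2)"
    by (cases "\<theta> \<ge> 0"; auto simp: abs_if)+
  have "exp (\<rho> / 2) * sin \<bar>\<theta> / 2\<bar> / \<bar>\<theta> / 2\<bar> * (\<theta> * a / 2) = exp (\<rho> / 2) * (sin (\<theta> / 2) * a)" for a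
    unfolding s(2)[symmetric] by simp
  from this[of "v$3"] this[of "- v$2"] this[of "v$1"] show ?thesis
    unfolding qexp.simps r Let_def s(1) by (simp add: quat_eq_iff rotor_def)
qed

lemma rotor_surj:
  assumes "norm p = 1"
  obtains v \<theta> where "norm v = 1" "rotor v \<theta> = p"
proof -
  define n where "n = sqrt (qI p * qI p + qJ p * qJ p + qK p * qK p)"
  have n2: "n * n = qI p * qI p + qJ p * qJ p + qK p * qK p" by (simp add: n_def)
  have "qRe p * qRe p + n * n = 1"
    using norm_quat_sq[of p] assms n2 by simp
  then have "(qRe p)\<^sup>2 + n\<^sup>2 = 1" by (simp add: power2_eq_square)
  then obtain t where t: "qRe p = cos t" "n = sin t"
    using sincos_total_2pi by blast
  show ?thesis
  proof (cases "n = 0")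
    \<comment> \<open>Here p is 1 or -1 and any axis will do. The value -1 is reached at angle 2 pi,
      a rotation trivial on frames but not on spin frames.\<close>
    case True
    then have "qI p * qI p + qJ p * qJ p + qK p * qK p = 0" using n2 by simp
    then have "qI p = 0" "qJ p = 0" "qK p = 0"
      by (smt (verit) zero_le_square mult_eq_0_iff)+
    then show ?thesis
      using that[of "vector [1, 0, 0]" "2 * t"] t True by (simp add: rotor_def norm3 quat_eq_iff)
  next
    case False
    let ?v = "vector [qK p / n, - qJ p / n, qI p / n] :: real^3"
    have "?v$1 * ?v$1 + ?v$2 * ?v$2 + ?v$3 * ?v$3 = (qI p * qI p + qJ p * qJ p + qK p * qK p) / (n * n)"
      by (simp add: add_divide_distrib)
    then have "norm ?v = 1" unfolding norm3 n2[symmetric] using False by simp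
    then show ?thesis
      using that[of ?v "2 * t"] t False by (simp add: rotor_def quat_eq_iff)
  qed
qed

text \<open>The rotation multiplies (1,1) by \<open>rotor v \<theta>\<close> on the right and the
  boost scales it by cosh + sinh = exp at \<rho>/2. The factor 2 is the pairing of (1,-1) with
  (1,1).\<close>

lemma sform_boost_rotation:
  "sform (cospinor (mat 1)) (spinor (boost \<rho> ** rotation v \<theta>)) = 2 *\<^sub>R (exp (\<rho> / 2) *\<^sub>R rotor v \<theta>)"
proof -
  have "exp (\<rho> / 2) = cosh (\<rho> / 2) + sinh (\<rho> / 2)" by (simp add: cosh_plus_sinh)
  then show ?thesis unfolding scaleR_2
    by (simp add: sform_def cospinor_def spinor_def boost_def rotation_def mat2_arith of_real_def
        scaleR_left_distrib)
qed

lemma continuous_on_boost [continuous_intros]: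
  "continuous_on S f \<Longrightarrow> continuous_on S (\<lambda>x. boost (f x))"
  unfolding boost_def by (intro continuous_intros) simp_all

lemma continuous_on_rotation [continuous_intros]:
  fixes f :: "'a::t2_space \<Rightarrow> real"
  shows "continuous_on S f \<Longrightarrow> continuous_on S (\<lambda>x. rotation v (f x))"
  unfolding rotation_def rotor_def by (intro continuous_intros) simp_all

section \<open>Evaluation of the lambda length\<close>

definition spinor_of :: "sdh \<Rightarrow> quat^2 \<Rightarrow> bool" where
  "spinor_of S \<kappa> \<longleftrightarrow> (\<forall>x\<in>horosphere (hpt S).
     (\<exists>A\<in>Sp11. spin_frame A = out_frame (hpt S) (hvi S) (hvj S) x \<and>
       Wout S x = {g. spin_lift g A} \<and> spinor A = \<kappa>) \<and>
     (\<exists>A\<in>Sp11. spin_frame A = in_frame (hpt S) (hvi S) (hvj S) x \<and>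
       Win S x = {g. spin_lift g A} \<and> Win S x \<noteq> {} \<and> cospinor A = rmul \<kappa> qk))"

lemma spinor_of_exists: "spin_decorated S \<Longrightarrow> \<exists>\<kappa>. spinor_of S \<kappa>"
  unfolding spinor_of_def using spin_decorated_spinor by metis

lemma spin_decorated_lightcone: "spin_decorated S \<Longrightarrow> hpt S \<in> lightcone"
  by (simp add: spin_decorated_def decoration_def Let_def)

lemma spinor_of_act:
  assumes "spin_decorated S" "spinor_of S \<kappa>"
  obtains A where "A \<in> Sp11" "spinor A = \<kappa>" "act A e04 = hpt S"
proof -
  obtain x where "x \<in> horosphere (hpt S)"
    using horosphere_nonempty spin_decorated_lightcone assms(1) by blast
  then obtain A where A: "A \<in> Sp11" "spin_frame A = out_frame (hpt S) (hvi S) (hvj S) x" "spinor A = \<kappa>"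
    using assms(2) unfolding spinor_of_def by blast
  then have "act A e04 = hpt S" by (simp add: act_e04 spin_frame_def out_frame_def N_out_def)
  then show ?thesis using that A by blast
qed

lemma sform_spinor_of_self:
  assumes "spin_decorated S" "spinor_of S \<kappa>" shows "sform \<kappa> \<kappa> = 0"
  using spinor_of_act[OF assms] sform_spinor_self by metis

lemma norm_sform_spinor_of:
  assumes "spin_decorated S" "spinor_of S \<kappa>" "spin_decorated S'" "spinor_of S' \<kappa>'"
  shows "(norm (sform \<kappa> \<kappa>'))\<^sup>2 = 2 * mink (hpt S) (hpt S')"
  using spinor_of_act[OF assms(1,2)] spinor_of_act[OF assms(3,4)] norm_sform_spinor by metis

text \<open>Translation and rotation turn the inward lift A1 into the outward lift A2 by right
  multiplication. Pairing the cospinor of A1, which is \<kappa>1 k, with the spinor of A2 yields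
  twice the lambda length; taking k out of the left slot conjugates it. As \<open>lam\<close> is a
  \<open>SOME\<close>, a value must be shown to exist and to be unique.\<close>

theorem lam_eq_sform:
  assumes S1: "spin_decorated S1" "spinor_of S1 \<kappa>1" and S2: "spin_decorated S2" "spinor_of S2 \<kappa>2"
  shows "lam S1 S2 = (1 / 2) *\<^sub>R (qcnj qk * sform \<kappa>1 \<kappa>2)"
proof (cases "same_centre (hpt S1) (hpt S2)")
  case True
  then obtain r where "hpt S2 = r *\<^sub>R hpt S1" unfolding same_centre_def by blast
  then have "mink (hpt S1) (hpt S2) = 0"
    using spin_decorated_lightcone[OF S1(1)] by (simp add: lightcone_def)
  then have "sform \<kappa>1 \<kappa>2 = 0" using norm_sform_spinor_of[OF S1 S2] by simp
  then show ?thesis using True by (simp add: lam_def Let_def zero_quat_def[symmetric])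
next
  case False
  define c1 c2 where "c1 = hpt S1" and "c2 = hpt S2"
  have c: "c1 \<in> lightcone" "c2 \<in> lightcone" "\<not> same_centre c1 c2" "\<not> same_centre c2 c1"
  proof -
    show "\<not> same_centre c2 c1"
    proof
      assume "same_centre c2 c1"
      then obtain r where "r > 0" "c1 = r *\<^sub>R c2" unfolding same_centre_def by blast
      then have "1 / r > 0 \<and> c2 = (1 / r) *\<^sub>R c1" by simp
      then show False using False unfolding same_centre_def c1_def c2_def by blast
    qed
  qed (use S1(1) S2(1) False in \<open>auto simp: c1_def c2_def spin_decorated_lightcone\<close>)
  define x1 x2 where "x1 = foot c1 c2" and "x2 = foot c2 c1"
  define m where "m = mink c1 c2"
  have m: "m > 0" "mink c2 c1 = m" using mink_lightcone_pos[OF c(1-3)] by (simp_all add: m_def mink_commute)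
  have x1: "x1 = (1 / 2) *\<^sub>R c1 + (1 / m) *\<^sub>R c2" "x1 \<in> horosphere c1" "gtan c1 c2 x1 = x1 - c1"
    using foot_gtan[OF c(1-3)] by (simp_all add: x1_def m_def)
  have x2: "x2 = (1 / 2) *\<^sub>R c2 + (1 / m) *\<^sub>R c1" "x2 \<in> horosphere c2"
    using foot_gtan[OF c(2,1,4)] m by (simp_all add: x2_def)
  obtain A1 where A1: "A1 \<in> Sp11" "spin_frame A1 = in_frame c1 (hvi S1) (hvj S1) x1"
      "Win S1 x1 = {g. spin_lift g A1}" "Win S1 x1 \<noteq> {}" "cospinor A1 = rmul \<kappa>1 qk"
    using S1(2) x1(2) unfolding spinor_of_def c1_def by metis
  obtain A2 where A2: "A2 \<in> Sp11" "spin_frame A2 = out_frame c2 (hvi S2) (hvj S2) x2"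
      "Wout S2 x2 = {g. spin_lift g A2}" "spinor A2 = \<kappa>2"
    using S2(2) x2(2) unfolding spinor_of_def c2_def by metis
  have a1: "x1 = act A1 (axis 0 1)" "x1 - c1 = act A1 (axis 4 1)"
    using A1(2) by (simp_all add: spin_frame_def in_frame_def N_in_def)
  have a2: "act A2 (axis 0 1) = x2" "act A2 (axis 4 1) = c2 - x2"
    using A2(2) by (simp_all add: spin_frame_def out_frame_def N_out_def)
  define tr where "tr \<rho> = (\<lambda>t. boost_frame x1 (x1 - c1) (t * \<rho>) (in_frame c1 (hvi S1) (hvj S1) x1))" for \<rho>
  define rp where "rp \<rho> v \<theta> = (\<lambda>t. rot_frame v (t * \<theta>) (tr \<rho> 1))" for \<rho> v \<theta>
  have tr: "tr \<rho> t = spin_frame (A1 ** boost (t * \<rho>))" for \<rho> t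
    unfolding tr_def A1(2)[symmetric] by (rule boost_frame_spin_frame[OF A1(1) a1])
  have rp: "rp \<rho> v \<theta> t = spin_frame (A1 ** boost \<rho> ** rotation v (t * \<theta>))" if "norm v = 1" for \<rho> v \<theta> t
    unfolding rp_def tr using A1(1) that by (subst rot_frame_spin_frame) simp_all
  have lift: "spin_lift (g +++ tr \<rho> +++ rp \<rho> v \<theta>) (A1 ** boost \<rho> ** rotation v \<theta>)"
    if v: "norm v = 1" and g: "g \<in> Win S1 x1" for g \<rho> v \<theta>
  proof -
    define h1 h2 where "h1 t = A1 ** boost (t * \<rho>)" and "h2 t = A1 ** boost \<rho> ** rotation v (t * \<theta>)" for t
    have h: "path h1" "path h2" "pathfinish h1 = pathstart h2"
      unfolding path_def h1_def h2_def by (auto intro!: continuous_intros simp: pathfinish_def pathstart_def)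
    have hi: "path_image h1 \<subseteq> Sp11" "path_image h2 \<subseteq> Sp11"
      using A1(1) v by (auto simp: path_image_def h1_def h2_def)
    have "spin_lift (g +++ tr \<rho> +++ rp \<rho> v \<theta>) (pathfinish (h1 +++ h2))"
    proof (rule spin_lift_join)
      show "spin_lift g A1" using g A1(3) by blast
      show "path (h1 +++ h2)" "path_image (h1 +++ h2) \<subseteq> Sp11"
        using h hi by (auto simp: path_image_join)
      show "pathstart (h1 +++ h2) = A1" by simp (simp add: pathstart_def h1_def)
      show "(tr \<rho> +++ rp \<rho> v \<theta>) t = spin_frame ((h1 +++ h2) t)" for t
        using v by (simp add: joinpaths_def tr rp h1_def h2_def)
    qed
    then show ?thesis by simp (simp add: pathfinish_def h2_def)
  qed
  define P where "P q \<longleftrightarrow> (\<exists>\<rho> \<theta> (v::real^3). norm v = 1 \<and> (fst (tr \<rho> 1) = x2 \<and>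
      (\<exists>g\<in>Win S1 x1. pclass (g +++ tr \<rho> +++ rp \<rho> v \<theta>) = Wout S2 x2)) \<and>
      q = qexp (Quat (\<rho> / 2) (\<theta> * v$3 / 2) (- \<theta> * v$2 / 2) (\<theta> * v$1 / 2)))" for q
  have lam: "lam S1 S2 = (SOME q. P q)"
    using False unfolding lam_def Let_def P_def rp_def tr_def x1(3)[symmetric]
    unfolding x1_def x2_def c1_def c2_def by simp
  \<comment> \<open>The parameters are not unique, as (\<theta>, v) may be replaced by (-\<theta>,
    -v) or \<theta> shifted by 4 pi. Only q is determined, through A1 and A2.\<close>
  have uniq: "q = (1 / 2) *\<^sub>R (qcnj qk * sform \<kappa>1 \<kappa>2)" if Pq: "P q" for q
  proof -
    obtain \<rho> \<theta> v g where q: "norm v = 1" "g \<in> Win S1 x1" "pclass (g +++ tr \<rho> +++ rp \<rho> v \<theta>) = Wout S2 x2"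
      "q = qexp (Quat (\<rho> / 2) (\<theta> * v$3 / 2) (- \<theta> * v$2 / 2) (\<theta> * v$1 / 2))"
      using Pq unfolding P_def by blast
    note l = lift[OF q(1,2)]
    have "spin_lift (g +++ tr \<rho> +++ rp \<rho> v \<theta>) A2"
      using q(3) l pclass_spin_lift[OF l] A2(3) by blast
    then have "A2 = A1 ** (boost \<rho> ** rotation v \<theta>)"
      using l homotopic_if_spin_lift spin_lift_monodromy by (metis matrix_mul_assoc)
    then have "sform (cospinor A1) (spinor A2) = 2 *\<^sub>R q"
      using A1(1) q(1,4) by (simp only: sform_spinors sform_boost_rotation qexp_rotor)
    then show ?thesis by (simp add: A1(5) A2(4) sform_rmul_left del: quat_scaleR_sel)
  qed
  have "\<exists>q. P q"
  proof -
    \<comment> \<open>Translation scales the two null directions of the geodesic plane by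
      exp(-\<rho>) for c1 and exp(\<rho>) for c2. Comparing c1/2 + c2/m with c1/m + c2/2 gives
      exp(\<rho>) = m/2.\<close>
    define \<rho> where "\<rho> = ln (m / 2)"
    have e: "exp \<rho> = m / 2" "exp (- \<rho>) = 2 / m" using m by (simp_all add: \<rho>_def exp_minus)
    have ch: "cosh \<rho> = (m / 2 + 2 / m) / 2" "sinh \<rho> = (m / 2 - 2 / m) / 2"
      unfolding cosh_def sinh_def e by simp_all
    define B where "B = A1 ** boost \<rho>"
    have B: "B \<in> Sp11" using A1(1) by (simp add: B_def)
    have B0: "act B (axis 0 1) = x2"
      using A1(1) m unfolding B_def
      by (simp add: act_boost a1[symmetric]) (simp add: x1 x2 ch vec_eq_iff field_simps)
    have B4: "act B (axis 4 1) = c2 - x2"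
      using A1(1) m unfolding B_def
      by (simp add: act_boost a1[symmetric]) (simp add: x1 x2 ch vec_eq_iff field_simps)
    \<comment> \<open>After the translation both frames have the same point and the same last
      vector, so D fixes the axes 0 and 4; it is diagonal with equal entries, hence a rotation about
      some axis.\<close>
    define D where "D = ginv B ** A2"
    have D: "D \<in> Sp11" "A2 = B ** D" using B A2(1) by (simp_all add: D_def)
    have "act D (axis 0 1) = axis 0 1"
      using B A2(1) by (simp add: D_def a2 B0[symmetric])
    then obtain p q where pq: "norm p = 1" "norm q = 1" "D = mat2 p 0 0 q"
      using stabilizer_diag D(1) by blast
    have "act D (axis 4 1) = axis 4 1"
      using B A2(1) by (simp add: D_def a2 B4[symmetric] del: act_diff)
    then have "p * qcnj q = 1" using act_diag(2)[OF pq(1,2), of "axis 4 1"] pq(3) by simp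
    then have "p * qcnj q * q = q" by simp
    then have "p = q" using pq(2) by (simp add: mult.assoc)
    obtain v \<theta> where v: "norm v = 1" "rotor v \<theta> = p" using rotor_surj[OF pq(1)] .
    have A2eq: "A2 = A1 ** boost \<rho> ** rotation v \<theta>"
      using D(2) pq(3) v \<open>p = q\<close> by (simp add: B_def rotation_def)
    obtain g where g: "g \<in> Win S1 x1" using A1(4) by blast
    have "pclass (g +++ tr \<rho> +++ rp \<rho> v \<theta>) = Wout S2 x2"
      using pclass_spin_lift[OF lift[OF v(1) g]] A2(3) A2eq by simp
    moreover have "fst (tr \<rho> 1) = x2"
      using B0 unfolding tr by (simp add: spin_frame_def B_def)
    ultimately show ?thesis unfolding P_def using g v(1) by blast
  qed
  then show ?thesis unfolding lam using uniq someI_ex by metis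
qed

lemma sform_spinor_of_nonzero:
  assumes "spin_decorated S" "spinor_of S \<kappa>" "spin_decorated S'" "spinor_of S' \<kappa>'"
    and "\<not> same_centre (hpt S) (hpt S')"
  shows "sform \<kappa> \<kappa>' \<noteq> 0"
  using norm_sform_spinor_of[OF assms(1-4)] mink_lightcone_pos[OF _ _ assms(5)]
    spin_decorated_lightcone assms(1,3) by fastforce

text \<open>The two assumptions on centres make the inverted quantities, from 0 to 2 and between 1
  and 3 in either direction, nonzero. The remaining lambda lengths may vanish.\<close>

theorem theorem1p3:
  fixes S0 S1 S2 S3 :: sdh
  assumes "spin_decorated S0" and "spin_decorated S1"
    and "spin_decorated S2" and "spin_decorated S3"
    and "\<not> same_centre (hpt S0) (hpt S2)"
    and "\<not> same_centre (hpt S1) (hpt S3)"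
  shows "qadd (qmult (qmult (qmult (qinv (lam S0 S2)) (lam S0 S1)) (qinv (lam S3 S1))) (lam S3 S2))
              (qmult (qmult (qmult (qinv (lam S0 S2)) (lam S0 S3)) (qinv (lam S1 S3))) (lam S1 S2))
         = qone"
proof -
  obtain \<kappa>0 \<kappa>1 \<kappa>2 \<kappa>3 where \<kappa>: "spinor_of S0 \<kappa>0" "spinor_of S1 \<kappa>1" "spinor_of S2 \<kappa>2" "spinor_of S3 \<kappa>3"
    using assms(1-4) spinor_of_exists by metis
  define c where "c = (1 / 2) *\<^sub>R qcnj qk"
  have c: "c \<noteq> 0" by (simp add: c_def quat_eq_iff)
  have lam: "lam S S' = c * sform \<kappa> \<kappa>'"
    if "spin_decorated S" "spinor_of S \<kappa>" "spin_decorated S'" "spinor_of S' \<kappa>'" for S S' \<kappa> \<kappa>'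
    using lam_eq_sform[OF that] by (simp add: c_def)
  have nz: "sform \<kappa>0 \<kappa>2 \<noteq> 0" "sform \<kappa>1 \<kappa>3 \<noteq> 0"
    using assms \<kappa> sform_spinor_of_nonzero by blast+
  then have "sform \<kappa>3 \<kappa>1 \<noteq> 0"
    using sform_commute[of \<kappa>3 \<kappa>1] by simp
  \<comment> \<open>Each summand consists of two pairs \<open>inverse lambda * lambda'\<close>, and
    the common left factor c cancels within each pair.\<close>
  have ci: "inverse c * (c * x) = x" for x
    using c by (simp add: mult.assoc[symmetric])
  have "sform \<kappa>0 \<kappa>2 = sform \<kappa>0 \<kappa>1 * inverse (sform \<kappa>3 \<kappa>1) * sform \<kappa>3 \<kappa>2
      + sform \<kappa>0 \<kappa>3 * inverse (sform \<kappa>1 \<kappa>3) * sform \<kappa>1 \<kappa>2"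
    using assms \<kappa> nz by (intro sform_ptolemy sform_spinor_of_self)
  then have "inverse (sform \<kappa>0 \<kappa>2) * (sform \<kappa>0 \<kappa>1 * inverse (sform \<kappa>3 \<kappa>1) * sform \<kappa>3 \<kappa>2
      + sform \<kappa>0 \<kappa>3 * inverse (sform \<kappa>1 \<kappa>3) * sform \<kappa>1 \<kappa>2) = 1"
    using nz by simp
  then show ?thesis
    using assms \<kappa> nz c \<open>sform \<kappa>3 \<kappa>1 \<noteq> 0\<close>
    by (simp add: plus_quat_def[symmetric] times_quat_def[symmetric] inverse_quat_def[symmetric]
        one_quat_def[symmetric] lam nonzero_inverse_mult_distrib mult.assoc ci distrib_left)
qed

end
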